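(* Let $\alpha>0$. Then $$\lim_{n\to\infty}(2n)^{\alpha}\left\| |x|^{\alpha}-P_{2n}^{(2)}\right\|_{L_\infty[0,1]}=\frac{2}{\pi}\left|\sin\frac{\pi\alpha}{2}\right|\,\left\|H(\alpha,\cdot)\right\|_{L_\infty[0,\infty)}=\frac{2}{\pi}\left|\sin\frac{\pi\alpha}{2}\right|\sup_{x\in[0,\infty)}\int_0^\infty\frac{t^\alpha}{\sinh(t)}\frac{x|\sin x|}{x^2+t^2}\,dt .$$
   Context: For $n\in\mathbb{N}$, $P_{2n}^{(2)}$ denotes the unique Lagrange interpolation polynomial of degree at most $2n$ to the function $x\mapsto|x|^\alpha$ on $[-1,1]$ at the $2n+1$ nodes $x_j^{(2n+1)}=\cos\frac{(j-1/2)\pi}{2n+1}$, $j=1,\dots,2n+1$ (the zeros of the Chebyshev polynomial $T_{2n+1}$, where $T_m(x)=\cos(m\arccos x)$). For $\alpha>0$, $x>0$, $H(\alpha,x)=\int_0^\infty \frac{t^\alpha}{\sinh t}\frac{x\sin x}{x^2+t^2}\,dt$, and $H(\alpha,0)=0$ (its limit as $x\to0^+$); the value at $x=0$ of the integral expression in the supremum is likewise understood as the limit, $0$. *)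

theory Defs
  imports
    "HOL-Analysis.Analysis"
    "HOL-Probability.Essential_Supremum"
    "HOL-Computational_Algebra.Polynomial"
begin

text \<open>The norm of \<open>L\<^sub>\<infinity>(S)\<close> with respect to Lebesgue measure. It is \<open>ereal\<close>-valued, so that an essentially
  unbounded function has norm \<open>\<infinity>\<close>, and so does, by the convention of \<^const>\<open>esssup\<close>, a
  non-measurable one.\<close>

definition Linf_norm :: "real set \<Rightarrow> (real \<Rightarrow> real) \<Rightarrow> ereal" where
  "Linf_norm S f = esssup (lebesgue_on S) (\<lambda>x. ereal \<bar>f x\<bar>)"

definition chebyshev_node :: "nat \<Rightarrow> nat \<Rightarrow> real" where
  "chebyshev_node m j = cos ((real j - 1/2) * pi / real m)"

text \<open>Existence and uniqueness of the polynomial described here are \<open>interp_poly_ex1\<close> below.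
  The middle node is \<open>0\<close>, where \<open>0 powr \<alpha> = 0\<close> is the intended value.\<close>

definition interp_poly :: "real \<Rightarrow> nat \<Rightarrow> real poly" where
  "interp_poly \<alpha> n = (THE p. degree p \<le> 2 * n \<and>
     (\<forall>j\<in>{1..2 * n + 1}. poly p (chebyshev_node (2 * n + 1) j) =
                          \<bar>chebyshev_node (2 * n + 1) j\<bar> powr \<alpha>))"

text \<open>At \<open>x = 0\<close> the integrand vanishes, so the formula also yields the limit value
  \<open>H \<alpha> 0 = 0\<close>. For \<open>\<alpha> > 0\<close> the integral converges for every \<open>x\<close> and \<open>H \<alpha>\<close> has a finite norm
  on \<open>[0, \<infinity>)\<close> (\<open>H_integrable\<close> and \<open>Linf_norm_H_finite\<close> below).\<close>

definition H :: "real \<Rightarrow> real \<Rightarrow> real" where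
  "H \<alpha> x = (LBINT t:{0<..}. t powr \<alpha> / sinh t * (x * sin x / (x\<^sup>2 + t\<^sup>2)))"

lemma H_0: "H \<alpha> 0 = 0"
  by (simp add: H_def set_lebesgue_integral_def)

lemma ex_interpolation:
  fixes g :: "real \<Rightarrow> real"
  assumes "finite A" "card A = Suc n"
  shows "\<exists>p. degree p \<le> n \<and> (\<forall>x\<in>A. poly p x = g x)"
proof -
  define L where "L a = (\<Prod>b\<in>A - {a}. smult (inverse (a - b)) [:- b, 1:])" for a
  have deg: "degree (L a) \<le> n" if "a \<in> A" for a
  proof -
    have "degree (L a) \<le> (\<Sum>b\<in>A - {a}. degree (smult (inverse (a - b)) [:- b, 1:]))"
      unfolding L_def using degree_prod_sum_le[of "A - {a}" "\<lambda>b. smult (inverse (a - b)) [:- b, 1:]"] assms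
      by (simp add: o_def)
    also have "\<dots> \<le> (\<Sum>b\<in>A - {a}. 1)"
      by (intro sum_mono) (auto intro: order.trans[OF degree_smult_le])
    also have "\<dots> = n"
      using that assms by simp
    finally show ?thesis .
  qed
  have val: "poly (L a) x = (if x = a then 1 else 0)" if "a \<in> A" "x \<in> A" for a x
  proof (cases "x = a")
    case True
    have "poly (L a) a = (\<Prod>b\<in>A - {a}. 1)"
      unfolding L_def poly_prod
    proof (rule prod.cong)
      fix b assume "b \<in> A - {a}"
      moreover have "poly (smult (inverse (a - b)) [:- b, 1:]) a = inverse (a - b) * (a - b)"
        by (simp add: algebra_simps)
      ultimately show "poly (smult (inverse (a - b)) [:- b, 1:]) a = 1" by simp
    qed simp
    with True show ?thesis by simp
  next
    case False
    with that assms show ?thesis by (auto simp: L_def poly_prod intro!: bexI[of _ x])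
  qed
  have "degree (\<Sum>a\<in>A. smult (g a) (L a)) \<le> n"
    using deg assms by (intro degree_sum_le) (auto intro: order.trans[OF degree_smult_le])
  moreover have "poly (\<Sum>a\<in>A. smult (g a) (L a)) x = g x" if "x \<in> A" for x
  proof -
    have "poly (\<Sum>a\<in>A. smult (g a) (L a)) x = (\<Sum>a\<in>A. if x = a then g a else 0)"
      unfolding poly_sum by (intro sum.cong) (auto simp: val that)
    also have "\<dots> = g x" using that assms by simp
    finally show ?thesis .
  qed
  ultimately show ?thesis by blast
qed

lemma inj_on_chebyshev_node: "inj_on (chebyshev_node m) {1..m}"
proof (rule inj_onI)
  fix i j assume ij: "i \<in> {1..m}" "j \<in> {1..m}" and eq: "chebyshev_node m i = chebyshev_node m j"
  have bd: "0 \<le> (real k - 1/2) * pi / real m \<and> (real k - 1/2) * pi / real m \<le> pi" if "k \<in> {1..m}" for k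
  proof -
    have "(real k - 1/2) * pi \<le> real m * pi"
      using that by (intro mult_right_mono) auto
    then show ?thesis using that by (auto simp: field_simps)
  qed
  have "(real i - 1/2) * pi / real m = (real j - 1/2) * pi / real m"
    by (rule cos_inj_pi) (use eq bd[OF ij(1)] bd[OF ij(2)] in \<open>simp_all add: chebyshev_node_def\<close>)
  then show "i = j" using ij by auto
qed

lemma interp_poly_ex1:
  "\<exists>!p. degree p \<le> 2 * n \<and>
     (\<forall>j\<in>{1..2 * n + 1}. poly p (chebyshev_node (2 * n + 1) j) =
                          \<bar>chebyshev_node (2 * n + 1) j\<bar> powr \<alpha>)"
proof -
  define A where "A = chebyshev_node (2 * n + 1) ` {1..2 * n + 1}"
  have A: "finite A" "card A = Suc (2 * n)"
    using card_image[OF inj_on_chebyshev_node[of "2 * n + 1"]] by (auto simp: A_def)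
  obtain p where p: "degree p \<le> 2 * n" "\<forall>x\<in>A. poly p x = \<bar>x\<bar> powr \<alpha>"
    using ex_interpolation[OF A, of "\<lambda>x. \<bar>x\<bar> powr \<alpha>"] by blast
  have "q = p" if "degree q \<le> 2 * n" "\<forall>x\<in>A. poly q x = \<bar>x\<bar> powr \<alpha>" for q
    by (rule poly_eqI_degree[of A]) (use p that A in auto)
  with p have "\<exists>!p. degree p \<le> 2 * n \<and> (\<forall>x\<in>A. poly p x = \<bar>x\<bar> powr \<alpha>)"
    by blast
  then show ?thesis unfolding A_def ball_simps by simp
qed

lemma borel_measurable_sinh [measurable (raw)]:
  fixes f :: "'a \<Rightarrow> real"
  assumes "f \<in> borel_measurable M"
  shows "(\<lambda>x. sinh (f x)) \<in> borel_measurable M"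
  using assms by (rule measurable_compose)
    (intro borel_measurable_continuous_onI continuous_on_sinh continuous_on_id)

lemma powr_div_sinh_integrable:
  fixes \<alpha> :: real assumes "\<alpha> > 0"
  shows "set_integrable lborel {0<..} (\<lambda>t. t powr \<alpha> / sinh t)"
proof -
  have G: "set_integrable lborel {0<..} (\<lambda>t::real. t powr (z - 1) / exp t)" if "z > 0" for z :: real
  proof -
    have "(\<lambda>t::real. t powr (z - 1) / exp t) absolutely_integrable_on {0..}"
      by (rule nonnegative_absolutely_integrable_1)
         (use has_integral_integrable[OF Gamma_integral_real[OF that]] in simp_all)
    then have "set_integrable lborel {0..} (\<lambda>t::real. t powr (z - 1) / exp t)"
      unfolding set_integrable_def by (subst (asm) integrable_completion) measurable
    then show ?thesis by (rule set_integrable_subset) auto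
  qed
  have bound: "norm (t powr \<alpha> / sinh t) \<le> norm (t powr (\<alpha> - 1) / exp t + 2 * (t powr (\<alpha> + 1 - 1) / exp t))"
    if "t > 0" for t :: real
  proof -
    have s: "sinh t = (exp t - exp (- t)) / 2" by (simp add: sinh_field_def)
    have pos: "sinh t > 0" using that by simp
    have "1 + 2 * t \<le> exp (2 * t)" by (rule exp_ge_add_one_self)
    then have "(1 + 2 * t) * exp (- t) \<le> exp (2 * t) * exp (- t)" by (intro mult_right_mono) auto
    also have "\<dots> = exp t" by (simp flip: exp_add)
    finally have e: "(1 + 2 * t) * exp (- t) \<le> exp t" .
    then have "t * exp t \<le> (1 + 2 * t) * sinh t" unfolding s by (simp add: algebra_simps)
    then have "t / sinh t \<le> (1 + 2 * t) / exp t" using pos by (simp add: divide_simps mult.commute)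
    then have "t powr (\<alpha> - 1) * (t / sinh t) \<le> t powr (\<alpha> - 1) * ((1 + 2 * t) / exp t)"
      by (rule mult_left_mono) simp
    moreover have eq: "t powr \<alpha> = t powr (\<alpha> - 1) * t"
      using that by (simp add: powr_diff)
    ultimately have "t powr \<alpha> / sinh t \<le> t powr (\<alpha> - 1) / exp t + 2 * (t powr (\<alpha>+1-1) / exp t)"
      by (simp add: add_divide_distrib ring_distribs mult_ac)
    moreover have "t powr \<alpha> / sinh t \<ge> 0" using pos by simp
    ultimately show ?thesis by simp
  qed
  have "set_integrable lborel {0<..} (\<lambda>t. t powr (\<alpha> - 1) / exp t + 2 * (t powr (\<alpha> + 1 - 1) / exp t))"
    by (intro set_integral_add(1) set_integrable_mult_right G) (use assms in simp_all)
  then show ?thesis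
  proof (rule set_integrable_bound)
    show "set_borel_measurable lborel {0<..} (\<lambda>t. t powr \<alpha> / sinh t)"
      unfolding set_borel_measurable_def by measurable
  qed (use bound in simp)
qed

lemma H_integrand_bound:
  fixes x t :: real assumes "t > 0"
  shows "\<bar>t powr \<alpha> / sinh t * (x * sin x / (x\<^sup>2 + t\<^sup>2))\<bar> \<le> t powr \<alpha> / sinh t"
proof -
  have "\<bar>x * sin x\<bar> \<le> \<bar>x\<bar> * \<bar>x\<bar>"
    unfolding abs_mult by (intro mult_left_mono abs_sin_x_le_abs_x) simp
  also have "\<dots> = x\<^sup>2" by (simp add: power2_eq_square)
  also have "\<dots> \<le> x\<^sup>2 + t\<^sup>2" by simp
  finally have "\<bar>x * sin x\<bar> / (x\<^sup>2 + t\<^sup>2) \<le> 1" by (intro divide_le_eq_1_pos[THEN iffD2]) (use assms in \<open>auto intro: add_nonneg_pos\<close>)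
  then have "\<bar>x * sin x / (x\<^sup>2 + t\<^sup>2)\<bar> \<le> 1" by (simp add: abs_divide)
  then have "\<bar>t powr \<alpha> / sinh t\<bar> * \<bar>x * sin x / (x\<^sup>2 + t\<^sup>2)\<bar> \<le> \<bar>t powr \<alpha> / sinh t\<bar> * 1"
    by (intro mult_left_mono) auto
  then show ?thesis unfolding abs_mult[symmetric] using assms by simp
qed

lemma H_integrable:
  fixes \<alpha> x :: real assumes "\<alpha> > 0"
  shows "set_integrable lborel {0<..} (\<lambda>t. t powr \<alpha> / sinh t * (x * sin x / (x\<^sup>2 + t\<^sup>2)))"
proof (rule set_integrable_bound[OF powr_div_sinh_integrable[OF assms]])
  show "set_borel_measurable lborel {0<..} (\<lambda>t. t powr \<alpha> / sinh t * (x * sin x / (x\<^sup>2 + t\<^sup>2)))"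
    unfolding set_borel_measurable_def by measurable
  have "norm (t powr \<alpha> / sinh t * (x * sin x / (x\<^sup>2 + t\<^sup>2))) \<le> norm (t powr \<alpha> / sinh t)" if "t > 0" for t
    using H_integrand_bound[OF that, of \<alpha> x] unfolding real_norm_def by linarith
  then show "AE t in lborel. t \<in> {0<..} \<longrightarrow>
      norm (t powr \<alpha> / sinh t * (x * sin x / (x\<^sup>2 + t\<^sup>2))) \<le> norm (t powr \<alpha> / sinh t)"
    by simp
qed

lemma H_measurable: "H \<alpha> \<in> borel_measurable borel"
proof -
  have "(\<lambda>(x::real, t). indicator {0<..} t *\<^sub>R (t powr \<alpha> / sinh t * (x * sin x / (x\<^sup>2 + t\<^sup>2))))
      \<in> borel_measurable (borel \<Otimes>\<^sub>M (borel :: real measure))"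
    unfolding split_beta' indicator_def greaterThan_iff by measurable
  also have "borel_measurable (borel \<Otimes>\<^sub>M (borel :: real measure)) =
      borel_measurable (borel \<Otimes>\<^sub>M (lborel :: real measure))"
    by (intro measurable_cong_sets sets_pair_measure_cong) simp_all
  finally show ?thesis
    unfolding set_lebesgue_integral_def H_def
    by (intro lborel.borel_measurable_lebesgue_integral) simp
qed

lemma Linf_norm_H_finite:
  assumes "\<alpha> > 0"
  shows "Linf_norm {0..} (H \<alpha>) < \<infinity>"
proof -
  define C where "C = (LBINT t:{0<..}. t powr \<alpha> / sinh t)"
  have bound: "\<bar>H \<alpha> x\<bar> \<le> C" for x
  proof -
    have "\<bar>H \<alpha> x\<bar> \<le> (LBINT t:{0<..}. \<bar>t powr \<alpha> / sinh t * (x * sin x / (x\<^sup>2 + t\<^sup>2))\<bar>)"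
      using set_integral_norm_bound[OF H_integrable[OF assms, of x]]
      unfolding H_def real_norm_def .
    also have "\<dots> \<le> C" unfolding C_def
      by (intro set_integral_mono set_integrable_abs H_integrable powr_div_sinh_integrable
          assms H_integrand_bound) simp
    finally show ?thesis .
  qed
  have "H \<alpha> \<in> borel_measurable (lebesgue_on {0..})"
    by (intro measurable_restrict_space1 measurable_completion) (simp add: H_measurable)
  then have "(\<lambda>x. ereal \<bar>H \<alpha> x\<bar>) \<in> borel_measurable (lebesgue_on {0..})"
    by measurable
  then have "Linf_norm {0..} (H \<alpha>) \<le> ereal C"
    unfolding Linf_norm_def by (rule esssup_I) (simp add: bound)
  then show ?thesis by (rule le_less_trans) simp
qed

end

theory Submission
  imports Defs "HOL-Real_Asymp.Real_Asymp"
begin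

text \<open>
  Write \<open>N = 2n + 1\<close>, \<open>x = sin \<phi>\<close>, so that \<open>\<bar>T\<^sub>N(x)\<bar> = \<bar>sin (N \<phi>)\<bar>\<close>. The Cauchy kernel
  \<open>x\<^sup>2 / (x\<^sup>2 + t\<^sup>2)\<close> is interpolated at the zeros of \<open>T\<^sub>N\<close> with the explicit error
  \<open>t sin \<phi> sin (N \<phi>) / ((x\<^sup>2 + t\<^sup>2) sinh (N arsinh t))\<close>, and \<open>\<bar>x\<bar>\<^sup>\<alpha>\<close> is a superposition of such kernels
  (Mellin transform; for \<open>\<alpha> = 2k + b\<close> with \<open>0 < b < 2\<close> multiply by \<open>x\<close> to the power \<open>2k\<close>, which changes the
  kernels only by polynomials and the factors \<open>(- t\<^sup>2)\<^sup>k\<close>). Interpolation being linear, integration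
  gives the error for \<open>\<bar>x\<bar>\<^sup>\<alpha>\<close>, and the scaling \<open>t = s / N\<close> turns \<open>N\<^sup>\<alpha>\<close> times it into the integral
  defining \<open>H\<close>, with \<open>sinh s\<close> replaced by \<open>sinh (N arsinh (s / N)) \<le> sinh s\<close> and \<open>y = N \<phi>\<close> by
  \<open>X = N sin \<phi>\<close> outside the factor \<open>\<bar>sin y\<bar>\<close>. The upper bound follows since this integral is at most
  \<open>y / X\<close> times \<open>\<bar>H(y)\<bar>\<close> plus a term that vanishes by dominated convergence, and is \<open>O(1 / X)\<close>, which is small
  where \<open>y / X\<close> is not close to 1; the lower bound from \<open>X \<rightarrow> y\<close> for each fixed \<open>y\<close>.
\<close>

section \<open>Integration and essential suprema\<close>

lemma set_dominated_convergence:
  fixes f :: "real \<Rightarrow> real" and s :: "nat \<Rightarrow> real \<Rightarrow> real"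
  assumes "A \<in> sets borel" "f \<in> borel_measurable borel" "\<And>i. s i \<in> borel_measurable borel"
    and "set_integrable lborel A w"
    and "\<And>t. t \<in> A \<Longrightarrow> (\<lambda>i. s i t) \<longlonglongrightarrow> f t"
    and "\<And>i t. t \<in> A \<Longrightarrow> \<bar>s i t\<bar> \<le> w t"
  shows "(\<lambda>i. LBINT t:A. s i t) \<longlonglongrightarrow> (LBINT t:A. f t)"
  unfolding set_lebesgue_integral_def
proof (rule integral_dominated_convergence)
  show "integrable lborel (\<lambda>t. indicator A t *\<^sub>R w t)"
    using assms(4) by (simp add: set_integrable_def)
  show "AE t in lborel. (\<lambda>i. indicator A t *\<^sub>R s i t) \<longlonglongrightarrow> indicator A t *\<^sub>R f t"
    using assms(5) by (auto split: split_indicator)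
  show "AE t in lborel. norm (indicator A t *\<^sub>R s i t) \<le> indicator A t *\<^sub>R w t" for i
    using assms(6) by (auto split: split_indicator)
qed (use assms(1-3) in measurable)

lemma set_integral_Ioi_scale:
  fixes f :: "real \<Rightarrow> real"
  assumes "c > 0"
  shows "set_integrable lborel {0<..} (\<lambda>t. f (c * t)) \<longleftrightarrow> set_integrable lborel {0<..} f"
    and "(LBINT t:{0<..}. f t) = c * (LBINT t:{0<..}. f (c * t))"
proof -
  have *: "indicator {0<..} (c * t) *\<^sub>R f (c * t) = indicator {0<..} t *\<^sub>R f (c * t)" for t
    using assms by (auto simp: indicator_def zero_less_mult_iff)
  show "set_integrable lborel {0<..} (\<lambda>t. f (c * t)) \<longleftrightarrow> set_integrable lborel {0<..} f"
    using lborel_integrable_real_affine_iff[of c "\<lambda>t. indicator {0<..} t *\<^sub>R f t" 0] assms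
    unfolding set_integrable_def by (simp only: * add_0)
  show "(LBINT t:{0<..}. f t) = c * (LBINT t:{0<..}. f (c * t))"
    using lborel_integral_real_affine[of c "\<lambda>t. indicator {0<..} t *\<^sub>R f t" 0] assms
    unfolding set_lebesgue_integral_def by (simp only: * add_0) simp
qed

text \<open>If some \<open>\<bar>f x\<bar>\<close> exceeded the norm, continuity would give a
  relatively open neighbourhood of \<open>x\<close> on which it still does. Since \<open>x\<close>
  lies in the closure of the interior, that neighbourhood contains a nonempty open set, which cannot
  be negligible. The closure condition rules out points, such as isolated ones, that the essential
  supremum does not see.\<close>

lemma Linf_norm_eq_SUP:
  assumes "S \<in> sets borel" "S \<subseteq> closure (interior S)" "continuous_on S f"
  shows "Linf_norm S f = (SUP x\<in>S. ereal \<bar>f x\<bar>)"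
proof (rule antisym)
  have "f \<in> borel_measurable (lebesgue_on S)"
    using assms by (intro continuous_imp_measurable_on_sets_lebesgue) auto
  then have m: "(\<lambda>x. ereal \<bar>f x\<bar>) \<in> borel_measurable (lebesgue_on S)" by measurable
  show "Linf_norm S f \<le> (SUP x\<in>S. ereal \<bar>f x\<bar>)"
    unfolding Linf_norm_def using m
    by (rule esssup_I) (auto intro!: AE_I2 SUP_upper)
  show "(SUP x\<in>S. ereal \<bar>f x\<bar>) \<le> Linf_norm S f"
  proof (rule SUP_least, rule ccontr)
    fix x assume "x \<in> S" and "\<not> ereal \<bar>f x\<bar> \<le> Linf_norm S f"
    then have x: "Linf_norm S f < ereal \<bar>f x\<bar>" by simp
    define V where "V = {y. Linf_norm S f < ereal \<bar>y\<bar>}"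
    have "open V"
      unfolding V_def by (intro open_Collect_less continuous_intros)
    have c: "continuous_on (interior S) f"
      using assms(3) interior_subset continuous_on_subset by blast
    define W where "W = interior S \<inter> f -` V"
    have "open W"
      unfolding W_def using continuous_on_open_vimage[of "interior S" f] c \<open>open V\<close>
      by (simp add: Int_commute)
    have "W \<noteq> {}"
    proof -
      obtain U where U: "open U" "U \<inter> S = f -` V \<inter> S"
        using assms(3) \<open>open V\<close> unfolding continuous_on_open_invariant by blast
      have "x \<in> U" using U(2) \<open>x \<in> S\<close> x by (auto simp: V_def)
      moreover have "x \<in> closure (interior S)" using \<open>x \<in> S\<close> assms(2) by blast
      ultimately have "U \<inter> interior S \<noteq> {}"
        using U(1) open_Int_closure_eq_empty by blast
      then show ?thesis using U(2) interior_subset[of S] by (auto simp: W_def)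
    qed
    have "AE x in lebesgue_on S. ereal \<bar>f x\<bar> \<le> Linf_norm S f"
      unfolding Linf_norm_def by (rule esssup_AE)
    then have "AE x in lebesgue. x \<in> S \<longrightarrow> ereal \<bar>f x\<bar> \<le> Linf_norm S f"
      using assms(1) by (subst (asm) AE_restrict_space_iff) auto
    then have "AE x in lebesgue. x \<notin> W"
      by eventually_elim (use interior_subset[of S] in \<open>auto simp: W_def V_def\<close>)
    then have "W \<in> null_sets lebesgue"
      using \<open>open W\<close> by (subst AE_iff_null_sets) auto
    then have "negligible W" by (simp add: negligible_iff_null_sets)
    then show False using open_not_negligible[OF \<open>open W\<close> \<open>W \<noteq> {}\<close>] by simp
  qed
qed

section \<open>Mellin transform of the Cauchy kernel\<close>

lemma Gamma_reflection_real:
  fixes x :: real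
  shows "Gamma x * Gamma (1 - x) = pi / sin (pi * x)"
proof -
  have "complex_of_real (Gamma x * Gamma (1 - x)) = Gamma (of_real x) * Gamma (1 - of_real x)"
    by (simp only: of_real_mult of_real_diff of_real_1 flip: Gamma_complex_of_real)
  also have "\<dots> = complex_of_real (pi / sin (pi * x))"
    by (simp only: Gamma_reflection_complex of_real_mult of_real_divide flip: sin_of_real)
  finally show ?thesis by (simp only: of_real_eq_iff)
qed

text \<open>The substitution \<open>u = t^2 / (1 + t^2)\<close> maps the half-line onto the unit
  interval and turns the integral into half of \<open>Beta (b/2) (1 - b/2)\<close>, which the
  reflection formula evaluates.\<close>

lemma integral_powr_div_one_plus_square:
  fixes b :: real
  assumes b: "0 < b" "b < 2"
  shows "set_integrable lborel {0<..} (\<lambda>t. t powr (b - 1) / (1 + t\<^sup>2))"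
    and "(LBINT t:{0<..}. t powr (b - 1) / (1 + t\<^sup>2)) = pi / (2 * sin (pi * b / 2))"
proof -
  define g :: "real \<Rightarrow> real" where "g = (\<lambda>t. t\<^sup>2 / (1 + t\<^sup>2))"
  define g' :: "real \<Rightarrow> real" where "g' = (\<lambda>t. 2 * t / (1 + t\<^sup>2)\<^sup>2)"
  define f :: "real \<Rightarrow> real" where "f = (\<lambda>u. u powr (b/2 - 1) * (1 - u) powr ((1 - b/2) - 1))"
  have pos: "1 + t\<^sup>2 > 0" for t :: real by (simp add: add_pos_nonneg)
  have img: "g ` {0<..} = {0<..<1}"
  proof (intro equalityI subsetI)
    fix u :: real assume u: "u \<in> {0<..<1}"
    have "g (sqrt (u / (1 - u))) = u"
      using u by (simp add: g_def divide_simps)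
    moreover have "sqrt (u / (1 - u)) \<in> {0<..}" using u by simp
    ultimately show "u \<in> g ` {0<..}" by (metis imageI)
  qed (use pos in \<open>auto simp: g_def\<close>)
  have inj: "inj_on g {0<..}"
  proof (rule inj_onI)
    fix s t :: real assume st: "s \<in> {0<..}" "t \<in> {0<..}" "g s = g t"
    then have "s\<^sup>2 * (1 + t\<^sup>2) = t\<^sup>2 * (1 + s\<^sup>2)"
      using pos[of s] pos[of t] by (simp add: g_def divide_simps)
    then have "s\<^sup>2 = t\<^sup>2" by (simp add: algebra_simps)
    then show "s = t" using st by (simp add: power2_eq_iff_nonneg)
  qed
  have der: "(g has_field_derivative g' t) (at t within {0<..})" for t
    unfolding g_def g'_def using pos[of t]
    by (auto intro!: derivative_eq_intros simp: field_simps power2_eq_square)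
  have "(f has_integral Beta (b/2) (1 - b/2)) {0..1}"
    unfolding f_def using has_integral_Beta_real[of "b/2" "1 - b/2"] b by simp
  then have hi: "(f has_integral Beta (b/2) (1 - b/2)) {0<..<1}"
    by (simp add: has_integral_Icc_iff_Ioo)
  then have ai: "f absolutely_integrable_on {0<..<1}"
    by (intro nonnegative_absolutely_integrable_1) (auto simp: f_def)
  have subst: "\<bar>g' t\<bar> * f (g t) = 2 * (t powr (b - 1) / (1 + t\<^sup>2))" if "t > 0" for t
  proof -
    have 1: "1 - g t = 1 / (1 + t\<^sup>2)" using pos[of t] by (simp add: g_def field_simps)
    have "f (g t) = (t powr (b - 2) / (1 + t\<^sup>2) powr (b/2 - 1)) * (1 / (1 + t\<^sup>2) powr (- (b/2)))"
      unfolding f_def 1 using that pos[of t]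
      by (simp add: g_def powr_divide powr_powr flip: powr_numeral)
    also have "\<dots> = t powr (b - 2) * (1 + t\<^sup>2)"
    proof -
      have "(1 + t\<^sup>2) powr (b/2 - 1) * (1 + t\<^sup>2) powr (- (b/2)) = 1 / (1 + t\<^sup>2)"
      proof -
        have "(1 + t\<^sup>2) powr (b/2 - 1) * (1 + t\<^sup>2) powr (- (b/2)) = (1 + t\<^sup>2) powr (- 1)"
          by (simp only: flip: powr_add) simp
        then show ?thesis using pos[of t] by (simp add: powr_minus_divide)
      qed
      then have "1 / ((1 + t\<^sup>2) powr (b/2 - 1) * (1 + t\<^sup>2) powr (- (b/2))) = 1 + t\<^sup>2" by simp
      then show ?thesis by (metis (no_types, lifting) mult.right_neutral times_divide_eq_right times_divide_times_eq)
    qed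
    finally have "\<bar>g' t\<bar> * f (g t) = 2 * (t powr (b - 2) * t) * ((1 + t\<^sup>2) / (1 + t\<^sup>2)\<^sup>2)"
      using that by (simp add: g'_def)
    also have "t powr (b - 2) * t = t powr (b - 1)"
      using that powr_mult_base[of t "b - 2"] by (simp add: mult.commute)
    also have "(1 + t\<^sup>2) / (1 + t\<^sup>2)\<^sup>2 = 1 / (1 + t\<^sup>2)" using pos[of t] by (simp add: power2_eq_square)
    finally show ?thesis by simp
  qed
  have "(\<lambda>t. \<bar>g' t\<bar> * f (g t)) absolutely_integrable_on {0<..} \<and>
      integral {0<..} (\<lambda>t. \<bar>g' t\<bar> * f (g t)) = Beta (b/2) (1 - b/2)"
    by (subst has_absolute_integral_change_of_variables_1'[OF _ der inj])
      (use ai hi img in \<open>auto simp: integral_unique\<close>)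
  then have i: "(\<lambda>t. 2 * (t powr (b - 1) / (1 + t\<^sup>2))) absolutely_integrable_on {0<..}"
    "integral {0<..} (\<lambda>t. 2 * (t powr (b - 1) / (1 + t\<^sup>2))) = Beta (b/2) (1 - b/2)"
    using subst
      set_integrable_cong[of lebesgue lebesgue "{0<..}" "{0<..}" "\<lambda>t. \<bar>g' t\<bar> * f (g t)" "\<lambda>t. 2 * (t powr (b - 1) / (1 + t\<^sup>2))"]
      integral_cong[of "{0<..}" "\<lambda>t. \<bar>g' t\<bar> * f (g t)" "\<lambda>t. 2 * (t powr (b - 1) / (1 + t\<^sup>2))"]
    by simp_all
  \<comment> \<open>The change of variables takes place over \<open>lebesgue\<close>; because the
    integrand is Borel measurable, its integrability carries over to \<open>lborel\<close>.\<close>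
  have "set_integrable lborel {0<..} (\<lambda>t. 2 * (t powr (b - 1) / (1 + t\<^sup>2)))"
    using i(1) unfolding set_integrable_def by (subst (asm) integrable_completion) measurable
  from set_integrable_mult_right[of "1/2", OF this]
  show I: "set_integrable lborel {0<..} (\<lambda>t. t powr (b - 1) / (1 + t\<^sup>2))" by simp
  have "(LBINT t:{0<..}. t powr (b - 1) / (1 + t\<^sup>2)) = Beta (b/2) (1 - b/2) / 2"
    using i(2) by (simp add: set_borel_integral_eq_integral(2)[OF I] del: times_divide_eq_right)
  also have "Beta (b/2) (1 - b/2) = pi / sin (pi * (b/2))"
    using Gamma_reflection_real[of "b/2"] by (simp add: Beta_def)
  finally show "(LBINT t:{0<..}. t powr (b - 1) / (1 + t\<^sup>2)) = pi / (2 * sin (pi * b / 2))" by simp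
qed

text \<open>Scaling \<open>t\<close> to \<open>x * t\<close> reduces the claim to
  \<open>x = 1\<close>.\<close>

lemma mellin_transform_cauchy_kernel:
  fixes b x :: real
  assumes b: "0 < b" "b < 2" and "x > 0"
  shows "set_integrable lborel {0<..} (\<lambda>t. t powr (b - 1) / (x\<^sup>2 + t\<^sup>2))"
    and "(LBINT t:{0<..}. t powr (b - 1) / (x\<^sup>2 + t\<^sup>2)) = x powr (b - 2) * (pi / (2 * sin (pi * b / 2)))"
proof -
  have *: "(x * t) powr (b - 1) / (x\<^sup>2 + (x * t)\<^sup>2) = x powr (b - 3) * (t powr (b - 1) / (1 + t\<^sup>2))"
    if "t \<in> {0<..}" for t
  proof -
    have "x powr (b - 1) = x powr (b - 3) * x\<^sup>2"
      using \<open>x > 0\<close> by (simp flip: powr_add powr_numeral)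
    moreover have "x\<^sup>2 + (x * t)\<^sup>2 = x\<^sup>2 * (1 + t\<^sup>2)" by (simp add: algebra_simps power2_eq_square)
    ultimately show ?thesis using \<open>x > 0\<close> that by (simp add: powr_mult)
  qed
  have "set_integrable lborel {0<..} (\<lambda>t. (x * t) powr (b - 1) / (x\<^sup>2 + (x * t)\<^sup>2))"
    using integral_powr_div_one_plus_square(1)[OF b]
    by (subst set_integrable_cong[OF refl refl *]) (auto simp del: times_divide_eq_right)
  then show "set_integrable lborel {0<..} (\<lambda>t. t powr (b - 1) / (x\<^sup>2 + t\<^sup>2))"
    by (subst (asm) set_integral_Ioi_scale(1)[OF \<open>x > 0\<close>])
  have "(LBINT t:{0<..}. t powr (b - 1) / (x\<^sup>2 + t\<^sup>2)) =
      x * (LBINT t:{0<..}. (x * t) powr (b - 1) / (x\<^sup>2 + (x * t)\<^sup>2))"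
    by (rule set_integral_Ioi_scale(2)[OF \<open>x > 0\<close>])
  also have "(LBINT t:{0<..}. (x * t) powr (b - 1) / (x\<^sup>2 + (x * t)\<^sup>2)) =
      (LBINT t:{0<..}. x powr (b - 3) * (t powr (b - 1) / (1 + t\<^sup>2)))"
    by (rule set_lebesgue_integral_cong) (use * in auto)
  also have "x * \<dots> = (x * x powr (b - 3)) * (pi / (2 * sin (pi * b / 2)))"
    using integral_powr_div_one_plus_square(2)[OF b]
    by (simp del: times_divide_eq_right add: mult.assoc)
  also have "x * x powr (b - 3) = x powr (b - 2)"
    using powr_mult_base[of x "b - 3"] \<open>x > 0\<close> by simp
  finally show "(LBINT t:{0<..}. t powr (b - 1) / (x\<^sup>2 + t\<^sup>2)) = x powr (b - 2) * (pi / (2 * sin (pi * b / 2)))" .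
qed

section \<open>Interpolation at the Chebyshev nodes\<close>

text \<open>Up to sign, \<open>U(x\<^sup>2) = x T\<^bsub>2n+1\<^esub>(x)\<close>; \<open>y = - (sinh u)\<^sup>2\<close> amounts to the imaginary argument \<open>x = \<i> sinh u\<close>.\<close>

lemma ex_poly_sin_mult_sin_odd:
  "\<exists>U :: real poly. degree U \<le> n + 1 \<and>
     (\<forall>x. poly U ((sin x)\<^sup>2) = sin x * sin ((2 * real n + 1) * x)) \<and>
     (\<forall>u. poly U (- (sinh u)\<^sup>2) = - (sinh u * sinh ((2 * real n + 1) * u)))"
proof (induction n rule: induct_nat_012)
  case 0
  show ?case by (rule exI[of _ "[:0, 1:]"]) (simp add: power2_eq_square)
next
  case 1
  have s: "sin (3 * x) = 3 * sin x - 4 * sin x ^ 3" for x :: real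
  proof -
    have "sin (3 * x) = sin (2 * x + x)" by (simp add: algebra_simps)
    also have "\<dots> = 2 * sin x * (cos x)\<^sup>2 + (1 - 2 * (sin x)\<^sup>2) * sin x"
      by (simp only: sin_add sin_double cos_double_sin) (simp add: algebra_simps power2_eq_square)
    also have "\<dots> = 3 * sin x - 4 * sin x ^ 3"
      unfolding cos_squared_eq by (simp add: algebra_simps power2_eq_square power3_eq_cube)
    finally show ?thesis .
  qed
  have sh: "sinh (3 * u) = 3 * sinh u + 4 * sinh u ^ 3" for u :: real
  proof -
    have "sinh (3 * u) = sinh (2 * u + u)" by (simp add: algebra_simps)
    also have "\<dots> = 2 * sinh u * (cosh u)\<^sup>2 + ((cosh u)\<^sup>2 + (sinh u)\<^sup>2) * sinh u"
      by (simp only: sinh_add sinh_double cosh_double) (simp add: algebra_simps power2_eq_square)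
    also have "\<dots> = 3 * sinh u + 4 * sinh u ^ 3"
      unfolding cosh_square_eq by (simp add: algebra_simps power2_eq_square power3_eq_cube)
    finally show ?thesis .
  qed
  show ?case
  proof (intro exI[of _ "[:0, 3, -4:]"] conjI allI)
    show "poly [:0, 3, -4:] ((sin x)\<^sup>2) = sin x * sin ((2 * real (Suc 0) + 1) * x)" for x
    proof -
      have "(2 * real (Suc 0) + 1) * x = 3 * x" by simp
      then show ?thesis by (simp only: s) (simp add: algebra_simps power2_eq_square power3_eq_cube)
    qed
    show "poly [:0, 3, -4:] (- (sinh u)\<^sup>2) = - (sinh u * sinh ((2 * real (Suc 0) + 1) * u))" for u
    proof -
      have "(2 * real (Suc 0) + 1) * u = 3 * u" by simp
      then show ?thesis by (simp only: sh) (simp add: algebra_simps power2_eq_square power3_eq_cube)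
    qed
  qed simp
next
  case (ge2 n)
  then obtain U V :: "real poly" where
    U: "degree U \<le> n + 1" "\<And>x. poly U ((sin x)\<^sup>2) = sin x * sin ((2 * real n + 1) * x)"
      "\<And>u. poly U (- (sinh u)\<^sup>2) = - (sinh u * sinh ((2 * real n + 1) * u))" and
    V: "degree V \<le> Suc n + 1" "\<And>x. poly V ((sin x)\<^sup>2) = sin x * sin ((2 * real (Suc n) + 1) * x)"
      "\<And>u. poly V (- (sinh u)\<^sup>2) = - (sinh u * sinh ((2 * real (Suc n) + 1) * u))"
    by metis
  \<comment> \<open>The values at \<open>?a + 2 * x\<close> and \<open>?a - 2 * x\<close> add up to
    \<open>2 * cos (2 * x) * sin ?a\<close>, and \<open>2 * cos (2 * x)\<close> is
    \<open>2 - 4 * y\<close> at \<open>y = (sin x)^2\<close>. The hyperbolic recurrence has the same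
    factor at \<open>y = - (sinh u)^2\<close>, so one polynomial recurrence serves both
    identities.\<close>
  have s: "sin ((2 * real (Suc (Suc n)) + 1) * x) =
      (2 - 4 * (sin x)\<^sup>2) * sin ((2 * real (Suc n) + 1) * x) - sin ((2 * real n + 1) * x)" for x :: real
  proof -
    let ?a = "(2 * real (Suc n) + 1) * x"
    have "(2 * real (Suc (Suc n)) + 1) * x = ?a + 2 * x" "(2 * real n + 1) * x = ?a - 2 * x"
      by (simp_all add: algebra_simps)
    moreover have "cos (2 * x) = 1 - 2 * (sin x)\<^sup>2"
      by (rule cos_double_sin)
    ultimately show ?thesis
      by (simp only: sin_add sin_diff) (simp add: algebra_simps)
  qed
  have sh: "sinh ((2 * real (Suc (Suc n)) + 1) * u) =
      (2 + 4 * (sinh u)\<^sup>2) * sinh ((2 * real (Suc n) + 1) * u) - sinh ((2 * real n + 1) * u)" for u :: real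
  proof -
    let ?a = "(2 * real (Suc n) + 1) * u"
    have "(2 * real (Suc (Suc n)) + 1) * u = ?a + 2 * u" "(2 * real n + 1) * u = ?a - 2 * u"
      by (simp_all add: algebra_simps)
    moreover have "cosh (2 * u) = 1 + 2 * (sinh u)\<^sup>2"
      by (simp add: cosh_double cosh_square_eq)
    ultimately show ?thesis
      by (simp only: sinh_add sinh_diff) (simp add: algebra_simps)
  qed
  show ?case
  proof (intro exI[of _ "[:2, -4:] * V - U"] conjI allI)
    have "degree ([:2, -4:] * V) \<le> degree [:2, -4 :: real:] + degree V"
      by (rule degree_mult_le)
    then show "degree ([:2, -4:] * V - U) \<le> Suc (Suc n) + 1"
      using U(1) V(1) by (intro degree_diff_le) auto
  qed (simp_all only: poly_diff poly_mult U(2,3) V(2,3) s sh, simp_all add: algebra_simps)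
qed

lemma synthetic_div_eval:
  fixes p :: "'a :: comm_ring_1 poly"
  shows "poly p y - poly p c = (y - c) * poly (synthetic_div p c) y"
  by (subst (1) synthetic_div_correct'[of c p, symmetric]) (simp add: algebra_simps)

text \<open>The weights \<open>l a x\<close> do not depend on \<open>q\<close>. Interpolation is
  thus a fixed finite linear combination of nodal values, which can be integrated over a parameter
  on which those values depend.\<close>

lemma ex_Lagrange_basis:
  fixes A :: "real set"
  assumes "finite A" "card A = Suc m"
  obtains l where "\<And>q x. degree q \<le> m \<Longrightarrow> poly q x = (\<Sum>a\<in>A. poly q a * l a x)"
proof -
  have "\<exists>p. degree p \<le> m \<and> (\<forall>x\<in>A. poly p x = (if x = a then 1 else 0))" for a
    by (rule ex_interpolation[OF assms])
  then obtain L where L: "\<And>a. degree (L a) \<le> m"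
    "\<And>a x. x \<in> A \<Longrightarrow> poly (L a) x = (if x = a then 1 else 0)"
    by metis
  have "q = (\<Sum>a\<in>A. smult (poly q a) (L a))" if "degree q \<le> m" for q
  proof (rule poly_eqI_degree[of A])
    have "degree (\<Sum>a\<in>A. smult (poly q a) (L a)) \<le> m"
      using L assms by (intro degree_sum_le) (auto intro: order.trans[OF degree_smult_le])
    then show "degree (\<Sum>a\<in>A. smult (poly q a) (L a)) < card A" "degree q < card A"
      using that assms by auto
    fix x assume "x \<in> A"
    then have "poly (\<Sum>a\<in>A. smult (poly q a) (L a)) x = (\<Sum>a\<in>A. if x = a then poly q a else 0)"
      unfolding poly_sum by (intro sum.cong) (auto simp: L(2))
    with \<open>x \<in> A\<close> assms show "poly q x = poly (\<Sum>a\<in>A. smult (poly q a) (L a)) x" by simp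
  qed
  then have "poly q x = (\<Sum>a\<in>A. poly q a * poly (L a) x)" if "degree q \<le> m" for q x
    using that by (metis (no_types, lifting) poly_smult poly_sum sum.cong)
  then show ?thesis by (rule that)
qed

text \<open>Put \<open>y = (sin x)^2\<close>. Both \<open>y ^ (k + 1)\<close> and \<open>U y\<close>
  differ from their values at \<open>y = - t^2\<close> by multiples of \<open>y + t^2\<close>. The
  first quotient leaves the remainder \<open>(- t^2) ^ (k + 1) / (y + t^2)\<close>; the second
  replaces \<open>1 / (y + t^2)\<close> by a polynomial plus a multiple of
  \<open>U y / (y + t^2)\<close>. The last term contains \<open>sin ((2 * real n + 1) * x)\<close>
  and so vanishes at the nodes, which makes \<open>q\<close> the interpolant.\<close>

lemma cauchy_kernel_interpolation_error:
  fixes t :: real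
  assumes "t > 0" "k \<le> n"
  obtains q where "degree q \<le> 2 * n"
    and "\<And>x. sin x ^ (2 * k + 2) / ((sin x)\<^sup>2 + t\<^sup>2) = poly q (sin x) +
      (- 1) ^ k * t ^ (2 * k + 1) * (sin x * sin ((2 * real n + 1) * x)) /
        (((sin x)\<^sup>2 + t\<^sup>2) * sinh ((2 * real n + 1) * arsinh t))"
proof -
  define S where "S = sinh ((2 * real n + 1) * arsinh t)"
  have S: "S > 0" using assms by (simp add: S_def)
  obtain U :: "real poly" where
    U: "degree U \<le> n + 1" "\<And>x. poly U ((sin x)\<^sup>2) = sin x * sin ((2 * real n + 1) * x)"
      "\<And>u. poly U (- (sinh u)\<^sup>2) = - (sinh u * sinh ((2 * real n + 1) * u))"
    using ex_poly_sin_mult_sin_odd by blast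
  \<comment> \<open>The hyperbolic identity at \<open>u = arsinh t\<close> gives the value of
    \<open>U\<close> at the pole of the kernel.\<close>
  have Ut: "poly U (- (t\<^sup>2)) = - (t * S)"
    using U(3)[of "arsinh t"] by (simp add: S_def)
  define W where "W = synthetic_div U (- (t\<^sup>2))"
  define W' where "W' = synthetic_div (monom 1 (k + 1)) (- (t\<^sup>2))"
  have W: "poly U y + t * S = (y + t\<^sup>2) * poly W y" for y :: real
    using synthetic_div_eval[of U y "- (t\<^sup>2)"] by (simp add: Ut W_def)
  have W': "y ^ (k + 1) - (- (t\<^sup>2)) ^ (k + 1) = (y + t\<^sup>2) * poly W' y" for y :: real
    using synthetic_div_eval[of "monom 1 (k + 1)" y "- (t\<^sup>2)"] by (simp add: W'_def poly_monom)
  \<comment> \<open>The two quotients have degree at most \<open>n\<close> in \<open>y\<close>, the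
    first because \<open>k \<le> n\<close>; composing with the square doubles the degree to at most
    \<open>2 * n\<close>.\<close>
  define q where "q = pcompose (W' + smult ((- (t\<^sup>2)) ^ (k + 1) / (t * S)) W) [:0, 0, 1:]"
  show ?thesis
  proof
    have "degree W \<le> n" "degree W' \<le> n"
      using U(1) assms by (simp_all add: W_def W'_def degree_synthetic_div degree_monom_eq)
    then have "degree (W' + smult ((- (t\<^sup>2)) ^ (k + 1) / (t * S)) W) \<le> n"
      by (intro degree_add_le) (auto intro: order.trans[OF degree_smult_le])
    then show "degree q \<le> 2 * n"
      unfolding q_def by (simp add: degree_pcompose)
    fix x :: real
    define y where "y = (sin x)\<^sup>2"
    have y: "y + t\<^sup>2 > 0" using assms by (simp add: y_def add_nonneg_pos)
    have p: "poly q (sin x) = poly W' y + (- (t\<^sup>2)) ^ (k + 1) / (t * S) * poly W y"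
      by (simp add: q_def poly_pcompose y_def power2_eq_square)
    have a: "poly W' y = (y ^ (k + 1) - (- (t\<^sup>2)) ^ (k + 1)) / (y + t\<^sup>2)"
      "poly W y = (sin x * sin ((2 * real n + 1) * x) + t * S) / (y + t\<^sup>2)"
      unfolding U(2)[of x, symmetric] y_def[symmetric] W[of y] W'[of y] using y by simp_all
    have b: "sin x ^ (2 * k + 2) = y ^ (k + 1)" by (simp add: y_def power_mult power_add power2_eq_square)
    have c: "(- (t\<^sup>2)) ^ (k + 1) = - ((- 1) ^ k * t ^ (2 * k + 1) * t)"
    proof -
      have "(- (t\<^sup>2)) ^ k = (- 1) ^ k * t ^ (2 * k)" by (subst power_minus) (simp add: power_mult)
      then show ?thesis by (simp add: power2_eq_square)
    qed
    show "sin x ^ (2 * k + 2) / ((sin x)\<^sup>2 + t\<^sup>2) = poly q (sin x) +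
      (- 1) ^ k * t ^ (2 * k + 1) * (sin x * sin ((2 * real n + 1) * x)) /
        (((sin x)\<^sup>2 + t\<^sup>2) * sinh ((2 * real n + 1) * arsinh t))"
      unfolding p a b c S_def[symmetric] y_def[symmetric]
      using S y \<open>t > 0\<close> by (simp add: divide_simps) (simp add: algebra_simps)
  qed
qed

section \<open>Error formula for \<open>\<bar>x\<bar> powr \<alpha>\<close>\<close>

lemma set_integral_sum:
  fixes f :: "'i \<Rightarrow> 'a \<Rightarrow> 'b :: {banach, second_countable_topology}"
  assumes "\<And>i. i \<in> I \<Longrightarrow> set_integrable M A (f i)"
  shows "set_integrable M A (\<lambda>x. \<Sum>i\<in>I. f i x)"
    and "(LINT x:A|M. \<Sum>i\<in>I. f i x) = (\<Sum>i\<in>I. LINT x:A|M. f i x)"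
  using assms unfolding set_integrable_def set_lebesgue_integral_def
  by (simp_all add: scaleR_sum_right)

definition cheb_nodes :: "nat \<Rightarrow> real set" where
  "cheb_nodes n = chebyshev_node (2 * n + 1) ` {1..2 * n + 1}"

lemma cheb_nodes: "finite (cheb_nodes n)" "card (cheb_nodes n) = Suc (2 * n)"
  using card_image[OF inj_on_chebyshev_node[of "2 * n + 1"]] by (auto simp: cheb_nodes_def)

text \<open>The complementary angle turns the cosine of the node into a sine, and multiplying it by
  \<open>2 * real n + 1\<close> gives the integer multiple \<open>n + 1 - j\<close> of
  \<open>pi\<close>. In this form the nodes are visibly zeros of the kernel's error term.\<close>

lemma cheb_nodes_sin:
  assumes "a \<in> cheb_nodes n"
  obtains x where "a = sin x" "sin ((2 * real n + 1) * x) = 0"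
proof -
  obtain j where j: "j \<in> {1..2 * n + 1}" "a = chebyshev_node (2 * n + 1) j"
    using assms by (auto simp: cheb_nodes_def)
  define x where "x = pi / 2 - (real j - 1 / 2) * pi / (2 * real n + 1)"
  have "a = sin x"
    by (simp add: j(2) chebyshev_node_def x_def sin_diff algebra_simps)
  moreover have "(2 * real n + 1) * x = of_int (int n + 1 - int j) * pi"
    by (simp add: x_def field_simps)
  then have "sin ((2 * real n + 1) * x) = 0"
    by (metis sin_zero_iff_int2)
  ultimately show ?thesis by (rule that)
qed

lemma interp_poly:
  shows "degree (interp_poly \<alpha> n) \<le> 2 * n"
    and "a \<in> cheb_nodes n \<Longrightarrow> poly (interp_poly \<alpha> n) a = \<bar>a\<bar> powr \<alpha>"
  using theI'[OF interp_poly_ex1[of n \<alpha>]] unfolding interp_poly_def[symmetric] cheb_nodes_def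
  by auto

text \<open>Here the function is itself a polynomial of degree at most \<open>2 * n\<close>, so
  uniqueness makes it its own interpolant.\<close>

lemma interp_poly_even:
  assumes "0 < k" "k \<le> n" "\<alpha> = 2 * real k"
  shows "poly (interp_poly \<alpha> n) x = \<bar>x\<bar> powr \<alpha>"
proof -
  have p: "\<bar>a\<bar> powr \<alpha> = poly (monom 1 (2 * k)) a" for a
  proof -
    \<comment> \<open>At \<open>a = 0\<close> this relies on \<open>0 < k\<close>: the value of
      \<open>0 powr 0\<close> is 0, whereas \<open>0 ^ 0\<close> is 1.\<close>
    have "\<bar>a\<bar> powr \<alpha> = \<bar>a\<bar> ^ (2 * k)"
      using powr_realpow'[of "\<bar>a\<bar>" "2 * k"] assms by simp
    then show ?thesis by (simp add: poly_monom power_even_abs)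
  qed
  have "interp_poly \<alpha> n = monom 1 (2 * k)"
  proof (rule poly_eqI_degree[of "cheb_nodes n"])
    show "degree (interp_poly \<alpha> n) < card (cheb_nodes n)"
      using interp_poly(1)[of \<alpha> n] by (simp add: cheb_nodes)
  qed (use assms p in \<open>auto simp: cheb_nodes interp_poly(2) degree_monom_eq\<close>)
  then show ?thesis by (simp add: p)
qed

text \<open>This is the Mellin formula multiplied by \<open>x ^ (2 * k + 2)\<close>. The factor also
  admits \<open>x = 0\<close>, where both sides vanish, so the representation holds at the middle
  node.\<close>

lemma powr_eq_mellin_integral:
  fixes b x :: real
  assumes b: "0 < b" "b < 2"
  shows "set_integrable lborel {0<..} (\<lambda>t. t powr (b - 1) * (x ^ (2 * k + 2) / (x\<^sup>2 + t\<^sup>2)))"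
    and "(LBINT t:{0<..}. t powr (b - 1) * (x ^ (2 * k + 2) / (x\<^sup>2 + t\<^sup>2))) =
      pi / (2 * sin (pi * b / 2)) * \<bar>x\<bar> powr (2 * real k + b)"
proof -
  have eq: "t powr (b - 1) * (x ^ (2 * k + 2) / (x\<^sup>2 + t\<^sup>2)) =
    x ^ (2 * k + 2) * (t powr (b - 1) / (\<bar>x\<bar>\<^sup>2 + t\<^sup>2))" for t by simp
  show "set_integrable lborel {0<..} (\<lambda>t. t powr (b - 1) * (x ^ (2 * k + 2) / (x\<^sup>2 + t\<^sup>2)))"
  proof (cases "x = 0")
    case True
    then show ?thesis by (simp add: set_integrable_def)
  next
    case False
    then show ?thesis unfolding eq
      by (intro set_integrable_mult_right mellin_transform_cauchy_kernel b) simp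
  qed
  show "(LBINT t:{0<..}. t powr (b - 1) * (x ^ (2 * k + 2) / (x\<^sup>2 + t\<^sup>2))) =
      pi / (2 * sin (pi * b / 2)) * \<bar>x\<bar> powr (2 * real k + b)"
  proof (cases "x = 0")
    case True
    then show ?thesis by (simp add: set_lebesgue_integral_def)
  next
    case False
    have "x ^ (2 * k + 2) = \<bar>x\<bar> ^ (2 * k + 2)" by (simp add: power_even_abs)
    also have "\<dots> = \<bar>x\<bar> powr (2 * real k + 2)"
      using False powr_realpow[of "\<bar>x\<bar>" "2 * k + 2"] by (simp add: add.commute)
    finally have "x ^ (2 * k + 2) * \<bar>x\<bar> powr (b - 2) = \<bar>x\<bar> powr (2 * real k + b)"
      by (simp flip: powr_add)
    moreover have "(LBINT t:{0<..}. t powr (b - 1) * (x ^ (2 * k + 2) / (x\<^sup>2 + t\<^sup>2))) =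
        x ^ (2 * k + 2) * (\<bar>x\<bar> powr (b - 2) * (pi / (2 * sin (pi * b / 2))))"
      unfolding eq set_integral_mult_right using False
      by (subst mellin_transform_cauchy_kernel(2)[OF b]) auto
    ultimately show ?thesis by (simp add: mult.assoc[symmetric])
  qed
qed

text \<open>By the Mellin formula, \<open>C\<close> times the function is the integral of the
  kernels \<open>F a t\<close> over \<open>t\<close>. Interpolation uses finitely many nodes with
  weights independent of \<open>t\<close>, so it commutes with this integral, and integrating the
  error of each kernel gives the error of the function.\<close>

lemma interp_poly_error:
  fixes b :: real
  assumes b: "0 < b" "b < 2" and "k \<le> n" and \<alpha>: "\<alpha> = 2 * real k + b"
  shows "\<bar>sin x\<bar> powr \<alpha> - poly (interp_poly \<alpha> n) (sin x) = 2 / pi * sin (pi * \<alpha> / 2) *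
    (LBINT t:{0<..}. t powr \<alpha> * (sin x * sin ((2 * real n + 1) * x)) /
        (((sin x)\<^sup>2 + t\<^sup>2) * sinh ((2 * real n + 1) * arsinh t)))"
proof -
  define A where "A = cheb_nodes n"
  obtain l where l: "\<And>q x. degree q \<le> 2 * n \<Longrightarrow> poly q x = (\<Sum>a\<in>A. poly q a * l a x)"
    using ex_Lagrange_basis[OF cheb_nodes] unfolding A_def by metis
  define F :: "real \<Rightarrow> real \<Rightarrow> real"
    where "F a t = t powr (b - 1) * (a ^ (2 * k + 2) / (a\<^sup>2 + t\<^sup>2))" for a t
  define C where "C = pi / (2 * sin (pi * b / 2))"
  note int = powr_eq_mellin_integral[OF b, where k = k, folded F_def C_def]
  have err: "F (sin x) t - (\<Sum>a\<in>A. F a t * l a (sin x)) =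
      (- 1) ^ k * (t powr \<alpha> * (sin x * sin ((2 * real n + 1) * x)) /
        (((sin x)\<^sup>2 + t\<^sup>2) * sinh ((2 * real n + 1) * arsinh t)))" if "t \<in> {0<..}" for t
  proof -
    have "t > 0" using that by simp
    then obtain q where q: "degree q \<le> 2 * n"
      "\<And>x. sin x ^ (2 * k + 2) / ((sin x)\<^sup>2 + t\<^sup>2) = poly q (sin x) +
        (- 1) ^ k * t ^ (2 * k + 1) * (sin x * sin ((2 * real n + 1) * x)) /
          (((sin x)\<^sup>2 + t\<^sup>2) * sinh ((2 * real n + 1) * arsinh t))"
      using cauchy_kernel_interpolation_error[OF _ \<open>k \<le> n\<close>] by metis
    \<comment> \<open>At a node the error term of the kernel is zero, so \<open>F a t\<close> agrees
      there with a polynomial of degree at most \<open>2 * n\<close>, which the Lagrange weights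
      reproduce.\<close>
    have "F a t = t powr (b - 1) * poly q a" if "a \<in> A" for a
      using that q(2) unfolding A_def F_def by (metis add.right_neutral cheb_nodes_sin div_0 mult_zero_right)
    then have "(\<Sum>a\<in>A. F a t * l a (sin x)) = t powr (b - 1) * poly q (sin x)"
      by (subst l[OF q(1)]) (simp add: sum_distrib_left mult.assoc)
    then have "F (sin x) t - (\<Sum>a\<in>A. F a t * l a (sin x)) =
       t powr (b - 1) * ((- 1) ^ k * t ^ (2 * k + 1) * (sin x * sin ((2 * real n + 1) * x)) /
          (((sin x)\<^sup>2 + t\<^sup>2) * sinh ((2 * real n + 1) * arsinh t)))"
      unfolding F_def q(2)[of x] by (simp only: distrib_left add_diff_cancel_left')
    moreover have "t powr \<alpha> = t powr (b - 1) * t ^ (2 * k + 1)"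
      using \<open>t > 0\<close> by (subst powr_realpow[symmetric]) (simp_all add: \<alpha> add.commute flip: powr_add)
    ultimately show ?thesis by simp
  qed
  have "set_integrable lborel {0<..} (\<lambda>t. F a t * l a (sin x))" for a
    by (intro set_integrable_mult_left) (rule int(1))
  then have sum: "set_integrable lborel {0<..} (\<lambda>t. \<Sum>a\<in>A. F a t * l a (sin x))"
    "(LBINT t:{0<..}. \<Sum>a\<in>A. F a t * l a (sin x)) = (\<Sum>a\<in>A. C * \<bar>a\<bar> powr \<alpha> * l a (sin x))"
    using set_integral_sum[of A lborel "{0<..}" "\<lambda>a t. F a t * l a (sin x)"] by (simp_all add: int \<alpha>)
  have "(- 1) ^ k * (LBINT t:{0<..}. t powr \<alpha> * (sin x * sin ((2 * real n + 1) * x)) /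
        (((sin x)\<^sup>2 + t\<^sup>2) * sinh ((2 * real n + 1) * arsinh t))) =
      (LBINT t:{0<..}. F (sin x) t - (\<Sum>a\<in>A. F a t * l a (sin x)))"
    unfolding set_integral_mult_right[symmetric]
    by (rule set_lebesgue_integral_cong) (use err in auto)
  also have "\<dots> = C * \<bar>sin x\<bar> powr \<alpha> - (\<Sum>a\<in>A. C * \<bar>a\<bar> powr \<alpha> * l a (sin x))"
    by (subst set_integral_diff(2)) (use sum in \<open>simp_all add: int \<alpha>\<close>)
  also have "(\<Sum>a\<in>A. C * \<bar>a\<bar> powr \<alpha> * l a (sin x)) = C * poly (interp_poly \<alpha> n) (sin x)"
    by (subst l) (simp_all add: interp_poly A_def sum_distrib_left mult.assoc)
  finally have "(- 1) ^ k * (LBINT t:{0<..}. t powr \<alpha> * (sin x * sin ((2 * real n + 1) * x)) /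
        (((sin x)\<^sup>2 + t\<^sup>2) * sinh ((2 * real n + 1) * arsinh t))) =
      C * (\<bar>sin x\<bar> powr \<alpha> - poly (interp_poly \<alpha> n) (sin x))" (is "_ * ?I = _ * ?E")
    by (simp add: algebra_simps)
  moreover have "sin (pi * b / 2) > 0"
    using b by (intro sin_gt_zero) (auto simp: field_simps)
  \<comment> \<open>The sign \<open>(- 1) ^ k\<close> of the kernel error and the constant
    \<open>1 / C = 2 / pi * sin (pi * b / 2)\<close> combine into the sine factor of the
    claim.\<close>
  moreover have "sin (pi * \<alpha> / 2) = (- 1) ^ k * sin (pi * b / 2)"
  proof -
    have "pi * \<alpha> / 2 = pi * b / 2 + real k * pi" by (simp add: \<alpha> field_simps)
    then show ?thesis by (simp only: sin_add) (simp add: mult.commute)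
  qed
  ultimately show ?thesis
    by (simp add: C_def field_simps)
qed

section \<open>The scaled hyperbolic sine\<close>

text \<open>The difference of the two sides vanishes at 0 and has derivative
  \<open>c * (cosh (c * v) - cosh v)\<close>, which is nonnegative.\<close>

lemma mult_sinh_le_sinh_mult:
  fixes c v :: real
  assumes "c \<ge> 1" "v \<ge> 0"
  shows "c * sinh v \<le> sinh (c * v)"
proof -
  have "(\<lambda>v. sinh (c * v) - c * sinh v) 0 \<le> (\<lambda>v. sinh (c * v) - c * sinh v) v"
  proof (rule DERIV_nonneg_imp_nondecreasing[OF assms(2)])
    fix u :: real assume u: "0 \<le> u" "u \<le> v"
    have "((\<lambda>v. sinh (c * v) - c * sinh v) has_real_derivative c * (cosh (c * u) - cosh u)) (at u)"
      by (auto intro!: derivative_eq_intros simp: algebra_simps)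
    moreover have "1 * u \<le> c * u" using assms u by (intro mult_right_mono) auto
    then have "cosh u \<le> cosh (c * u)" using u by (subst cosh_real_nonneg_le_iff) auto
    ultimately show "\<exists>y. ((\<lambda>v. sinh (c * v) - c * sinh v) has_real_derivative y) (at u) \<and> 0 \<le> y"
      using assms by (intro exI[of _ "c * (cosh (c * u) - cosh u)"]) auto
  qed
  then show ?thesis by simp
qed

lemma arsinh_real_nonneg: "x \<ge> 0 \<Longrightarrow> arsinh x \<ge> (0 :: real)"
  using arsinh_real_neg_iff[of x] by linarith

text \<open>The hyperbolic factor of the error integral after the substitution
  \<open>t = s / c\<close>. It increases with \<open>c\<close> and tends to \<open>sinh s\<close>,
  so it is the counterpart of \<open>sinh\<close> for finite \<open>n\<close>.\<close>

definition scaled_sinh :: "real \<Rightarrow> real \<Rightarrow> real" where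
  "scaled_sinh c s = sinh (c * arsinh (s / c))"

text \<open>Apply \<open>mult_sinh_le_sinh_mult\<close> with the ratio \<open>c / b\<close> at
  \<open>arsinh (s / c)\<close>; this compares \<open>s / b\<close> with a hyperbolic sine, and
  applying \<open>arsinh\<close> yields the comparison of arguments.\<close>

lemma scaled_sinh_mono:
  assumes "0 < b" "b \<le> c" "s \<ge> 0"
  shows "scaled_sinh b s \<le> scaled_sinh c s"
proof -
  define v where "v = arsinh (s / c)"
  have "c / b * sinh v \<le> sinh (c / b * v)"
    using assms by (intro mult_sinh_le_sinh_mult) (auto simp: v_def arsinh_real_nonneg)
  then have "s / b \<le> sinh (c / b * v)"
    using assms by (simp add: v_def)
  then have "arsinh (s / b) \<le> c / b * v"
    by (subst sinh_real_le_iff[symmetric]) simp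
  then show ?thesis
    using assms by (simp add: scaled_sinh_def v_def field_simps)
qed

lemma scaled_sinh_ge_self:
  assumes "c \<ge> 1" "s \<ge> 0"
  shows "s \<le> scaled_sinh c s"
  using mult_sinh_le_sinh_mult[of c "arsinh (s / c)"] assms by (simp add: scaled_sinh_def arsinh_real_nonneg)

lemma scaled_sinh_pos: "c > 0 \<Longrightarrow> s > 0 \<Longrightarrow> scaled_sinh c s > 0"
  by (simp add: scaled_sinh_def)

text \<open>Induction with the addition formula: since \<open>sinh v \<le> cosh v\<close>, the
  product \<open>sinh v * sinh a\<close> is at most \<open>sinh (v + a)\<close>.\<close>

lemma sinh_power_le: "v \<ge> 0 \<Longrightarrow> sinh v ^ Suc m \<le> sinh (real (Suc m) * v)" for v :: real
proof (induction m)
  case (Suc m)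
  let ?a = "real (Suc m) * v"
  have "sinh v ^ Suc (Suc m) \<le> sinh v * sinh ?a"
    using Suc by (auto intro!: mult_left_mono)
  also have "sinh v * sinh ?a \<le> cosh v * sinh ?a"
    using Suc.prems by (intro mult_right_mono) (auto simp: sinh_le_cosh_real less_imp_le)
  also have "\<dots> \<le> sinh (v + ?a)"
    using Suc.prems by (simp add: sinh_add)
  also have "v + ?a = real (Suc (Suc m)) * v" by (simp add: algebra_simps)
  finally show ?case .
qed simp

text \<open>Although \<open>scaled_sinh c\<close> does not grow exponentially, this polynomial
  growth of order \<open>m\<close> is enough for integrability at infinity.\<close>

lemma scaled_sinh_ge_power:
  assumes "m > 0" "s \<ge> 0"
  shows "(s / real m) ^ m \<le> scaled_sinh (real m) s"
  using sinh_power_le[of "arsinh (s / real m)" "m - 1"] assms by (simp add: scaled_sinh_def arsinh_real_nonneg)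

text \<open>For \<open>s \<noteq> 0\<close> this is the difference quotient of \<open>arsinh\<close>
  at 0 with increment \<open>s / c\<close>; the derivative there is 1.\<close>

lemma arsinh_tendsto: "((\<lambda>c::real. c * arsinh (s / c)) \<longlongrightarrow> s) at_top"
proof (cases "s = 0")
  case False
  have d: "(arsinh has_real_derivative 1) (at (0::real))"
    by (auto intro!: derivative_eq_intros)
  then have "((\<lambda>h::real. arsinh h / h) \<longlongrightarrow> 1) (at 0)"
    by (simp add: DERIV_def)
  moreover have "filterlim (\<lambda>c. s / c) (at 0) at_top"
    using False by real_asymp
  ultimately have "((\<lambda>c. arsinh (s / c) / (s / c)) \<longlongrightarrow> 1) at_top"
    by (rule filterlim_compose)
  then have "((\<lambda>c. s * (arsinh (s / c) / (s / c))) \<longlongrightarrow> s * 1) at_top"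
    by (intro tendsto_intros)
  then show ?thesis using False by (simp add: mult.commute)
qed simp

lemma scaled_sinh_tendsto: "((\<lambda>c. scaled_sinh c s) \<longlongrightarrow> sinh s) at_top"
  unfolding scaled_sinh_def by (intro tendsto_sinh arsinh_tendsto)

lemma scaled_sinh_le_sinh:
  assumes "c > 0" "s \<ge> 0"
  shows "scaled_sinh c s \<le> sinh s"
proof (rule tendsto_lowerbound[OF scaled_sinh_tendsto])
  show "\<forall>\<^sub>F b in at_top. scaled_sinh c s \<le> scaled_sinh b s"
    using eventually_ge_at_top[of c] by eventually_elim (use assms in \<open>auto intro: scaled_sinh_mono\<close>)
qed simp

lemma borel_measurable_arsinh [measurable (raw)]:
  fixes f :: "'a \<Rightarrow> real"
  assumes "f \<in> borel_measurable M"
  shows "(\<lambda>x. arsinh (f x)) \<in> borel_measurable M"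
  using assms by (rule measurable_compose)
    (intro borel_measurable_continuous_onI continuous_on_arsinh continuous_on_id)

lemma borel_measurable_scaled_sinh [measurable]: "scaled_sinh c \<in> borel_measurable borel"
  unfolding scaled_sinh_def by measurable

text \<open>The majorant is a multiple of \<open>s powr (b - 1) / (1 + s^2)\<close>. On
  \<open>s \<le> 1\<close> the bound \<open>s \<le> scaled_sinh m s\<close> is used. For
  \<open>s > 1\<close> the power bound leaves the exponent
  \<open>\<alpha> - m \<le> - 3 \<le> b - 3\<close>, which is where the 3 in the condition on
  \<open>m\<close> comes from.\<close>

lemma integrable_powr_div_scaled_sinh:
  assumes "\<alpha> > 0" "real m \<ge> \<alpha> + 3" "c \<ge> real m"
  shows "set_integrable lborel {0<..} (\<lambda>s. s powr \<alpha> / scaled_sinh c s)"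
proof -
  define b where "b = min \<alpha> 1"
  have b: "0 < b" "b < 2" "b \<le> \<alpha>" "b \<le> 1" using assms by (auto simp: b_def)
  have m: "m \<ge> 1" using assms by linarith
  \<comment> \<open>The factor \<open>m ^ m\<close> comes from \<open>(s / m) ^ m\<close>, and the 2
    from \<open>1 + s^2\<close> being at most 2 for \<open>s \<le> 1\<close> and at most
    \<open>2 * s^2\<close> otherwise.\<close>
  let ?g = "\<lambda>s. 2 * real m ^ m * (s powr (b - 1) / (1 + s\<^sup>2))"
  have bound: "norm (s powr \<alpha> / scaled_sinh c s) \<le> norm (?g s)" if "s \<in> {0<..}" for s
  proof -
    have s: "s > 0" using that by simp
    have R: "scaled_sinh (real m) s > 0" "scaled_sinh (real m) s \<le> scaled_sinh c s" "scaled_sinh c s > 0"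
      using s m assms by (auto intro: scaled_sinh_pos scaled_sinh_mono)
    have "s powr \<alpha> / scaled_sinh c s \<le> s powr \<alpha> / scaled_sinh (real m) s"
      using R by (intro divide_left_mono) auto
    also have "\<dots> \<le> ?g s"
    proof (cases "s \<le> 1")
      case True
      have "s powr \<alpha> / scaled_sinh (real m) s \<le> s powr \<alpha> / s"
        using R s m by (intro divide_left_mono scaled_sinh_ge_self) auto
      also have "\<dots> = s powr (\<alpha> - 1)" using s by (simp add: powr_diff)
      also have "\<dots> \<le> s powr (b - 1)" using s True b by (intro powr_mono') auto
      also have "\<dots> = (1 + s\<^sup>2) * (s powr (b - 1) / (1 + s\<^sup>2))"
        using add_pos_nonneg[of 1 "s\<^sup>2"] by simp
      also have "\<dots> \<le> (2 * real m ^ m) * (s powr (b - 1) / (1 + s\<^sup>2))"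
      proof (rule mult_right_mono)
        have "s\<^sup>2 \<le> 1" using True s by (simp add: power_le_one)
        moreover have "1 \<le> real m ^ m" using m by simp
        ultimately show "1 + s\<^sup>2 \<le> 2 * real m ^ m" by linarith
      qed simp
      finally show ?thesis .
    next
      case False
      have "s powr \<alpha> / scaled_sinh (real m) s \<le> s powr \<alpha> / (s / real m) ^ m"
        using R s m by (intro divide_left_mono scaled_sinh_ge_power) auto
      also have "\<dots> = real m ^ m * s powr (\<alpha> - real m)"
        using s by (simp add: powr_diff powr_realpow power_divide)
      also have "\<dots> \<le> real m ^ m * s powr (b - 1 - 2)"
        using False assms b by (intro mult_left_mono powr_mono) auto
      also have "s powr (b - 1 - 2) = s powr (b - 1) / s\<^sup>2"
        using s by (subst powr_diff) (simp flip: powr_numeral)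
      also have "\<dots> \<le> 2 * (s powr (b - 1) / (1 + s\<^sup>2))"
      proof -
        have "1 \<le> s\<^sup>2" using False by (intro one_le_power) auto
        then have "s powr (b - 1) / s\<^sup>2 \<le> s powr (b - 1) / ((1 + s\<^sup>2) / 2)"
          by (intro divide_left_mono mult_pos_pos) (auto simp: add_pos_nonneg)
        then show ?thesis by (simp add: mult.commute)
      qed
      finally show ?thesis using m by (simp add: mult.assoc mult.left_commute)
    qed
    finally show ?thesis using R s by (simp add: add_nonneg_nonneg)
  qed
  have "set_integrable lborel {0<..} ?g"
    by (intro set_integrable_mult_right integral_powr_div_one_plus_square b)
  then show ?thesis
  proof (rule set_integrable_bound)
    show "set_borel_measurable lborel {0<..} (\<lambda>s. s powr \<alpha> / scaled_sinh c s)"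
      unfolding set_borel_measurable_def by measurable
  qed (use bound in simp)
qed

section \<open>Kernel integrals and their relation to \<open>H\<close>\<close>

text \<open>The part of \<open>H\<close> that remains when \<open>sin x / x\<close> is split off,
  with \<open>sinh\<close> generalised to \<open>g\<close> so that \<open>scaled_sinh\<close> is
  covered too. Unlike \<open>H\<close>, it is nonnegative and nondecreasing in
  \<open>x \<ge> 0\<close> for positive \<open>g\<close>.\<close>

definition kernel_integral :: "real \<Rightarrow> (real \<Rightarrow> real) \<Rightarrow> real \<Rightarrow> real" where
  "kernel_integral \<alpha> g x = (LBINT s:{0<..}. s powr \<alpha> / g s * (x\<^sup>2 / (x\<^sup>2 + s\<^sup>2)))"

lemma square_fraction_bounds:
  fixes x s :: real
  assumes "s > 0"
  shows "0 \<le> x\<^sup>2 / (x\<^sup>2 + s\<^sup>2)" "x\<^sup>2 / (x\<^sup>2 + s\<^sup>2) \<le> 1"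
    and "0 \<le> x \<Longrightarrow> x \<le> y \<Longrightarrow> x\<^sup>2 / (x\<^sup>2 + s\<^sup>2) \<le> y\<^sup>2 / (y\<^sup>2 + s\<^sup>2)"
proof -
  have pos: "u\<^sup>2 + s\<^sup>2 > 0" for u using assms by (simp add: add_nonneg_pos)
  show "0 \<le> x\<^sup>2 / (x\<^sup>2 + s\<^sup>2)" "x\<^sup>2 / (x\<^sup>2 + s\<^sup>2) \<le> 1" using pos[of x] by auto
  assume "0 \<le> x" "x \<le> y"
  then have "x\<^sup>2 \<le> y\<^sup>2" by (intro power_mono)
  then have "x\<^sup>2 * s\<^sup>2 \<le> y\<^sup>2 * s\<^sup>2" by (intro mult_right_mono) auto
  then show "x\<^sup>2 / (x\<^sup>2 + s\<^sup>2) \<le> y\<^sup>2 / (y\<^sup>2 + s\<^sup>2)"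
    using pos[of x] pos[of y] by (simp add: divide_simps) (simp add: algebra_simps)
qed

lemma kernel_integral_integrable:
  fixes \<alpha> x :: real
  assumes g: "g \<in> borel_measurable borel" "\<And>s. s > 0 \<Longrightarrow> g s > 0"
    and int: "set_integrable lborel {0<..} (\<lambda>s. s powr \<alpha> / g s)"
  shows "set_integrable lborel {0<..} (\<lambda>s. s powr \<alpha> / g s * (x\<^sup>2 / (x\<^sup>2 + s\<^sup>2)))"
proof (rule set_integrable_bound[OF int])
  have "(\<lambda>s. s powr \<alpha> / g s * (x\<^sup>2 / (x\<^sup>2 + s\<^sup>2))) \<in> borel_measurable borel"
    by (intro borel_measurable_times borel_measurable_divide g(1)) measurable
  then show "set_borel_measurable lborel {0<..} (\<lambda>s. s powr \<alpha> / g s * (x\<^sup>2 / (x\<^sup>2 + s\<^sup>2)))"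
    unfolding set_borel_measurable_def by (intro borel_measurable_scaleR) auto
  have "norm (s powr \<alpha> / g s * (x\<^sup>2 / (x\<^sup>2 + s\<^sup>2))) \<le> norm (s powr \<alpha> / g s)" if "s > 0" for s
  proof -
    have "0 \<le> s powr \<alpha> / g s" using g(2)[OF that] by simp
    then have "s powr \<alpha> / g s * (x\<^sup>2 / (x\<^sup>2 + s\<^sup>2)) \<le> s powr \<alpha> / g s"
      "0 \<le> s powr \<alpha> / g s * (x\<^sup>2 / (x\<^sup>2 + s\<^sup>2))"
      using square_fraction_bounds(1,2)[OF that, of x] by (intro mult_right_le_one_le mult_nonneg_nonneg; simp)+
    then show ?thesis unfolding real_norm_def by linarith
  qed
  then show "AE s in lborel. s \<in> {0<..} \<longrightarrow>
      norm (s powr \<alpha> / g s * (x\<^sup>2 / (x\<^sup>2 + s\<^sup>2))) \<le> norm (s powr \<alpha> / g s)"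
    by (intro AE_I2 impI) simp_all
qed

lemma kernel_integral_nonneg:
  assumes "\<And>s. s > 0 \<Longrightarrow> g s > 0"
  shows "kernel_integral \<alpha> g x \<ge> 0"
  unfolding kernel_integral_def set_lebesgue_integral_def
  by (intro Bochner_Integration.integral_nonneg)
    (auto simp: indicator_def less_imp_le assms)

lemma kernel_integral_le:
  assumes g: "g \<in> borel_measurable borel" "\<And>s. s > 0 \<Longrightarrow> g s > 0"
    and int: "set_integrable lborel {0<..} (\<lambda>s. s powr \<alpha> / g s)"
  shows "kernel_integral \<alpha> g x \<le> (LBINT s:{0<..}. s powr \<alpha> / g s)"
  unfolding kernel_integral_def
proof (rule set_integral_mono[OF kernel_integral_integrable[OF g int] int])
  fix s :: real assume "s \<in> {0<..}"
  then have s: "s > 0" by simp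
  show "s powr \<alpha> / g s * (x\<^sup>2 / (x\<^sup>2 + s\<^sup>2)) \<le> s powr \<alpha> / g s"
    using square_fraction_bounds[OF s, of x] g(2)[OF s] by (intro mult_right_le_one_le) auto
qed

lemma kernel_integral_mono:
  assumes g: "g \<in> borel_measurable borel" "\<And>s. s > 0 \<Longrightarrow> g s > 0"
    and int: "set_integrable lborel {0<..} (\<lambda>s. s powr \<alpha> / g s)"
    and xy: "0 \<le> x" "x \<le> y"
  shows "kernel_integral \<alpha> g x \<le> kernel_integral \<alpha> g y"
  unfolding kernel_integral_def
proof (rule set_integral_mono[OF kernel_integral_integrable[OF g int] kernel_integral_integrable[OF g int]])
  fix s :: real assume "s \<in> {0<..}"
  then have s: "s > 0" by simp
  show "s powr \<alpha> / g s * (x\<^sup>2 / (x\<^sup>2 + s\<^sup>2)) \<le> s powr \<alpha> / g s * (y\<^sup>2 / (y\<^sup>2 + s\<^sup>2))"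
    using square_fraction_bounds(3)[OF s xy] g(2)[OF s] by (intro mult_left_mono) auto
qed

text \<open>Since the fraction lies between 0 and 1, replacing \<open>g\<close> by \<open>h\<close>
  costs at most the difference of the full integrals. That bound does not depend on
  \<open>x\<close>, which makes the later estimate uniform.\<close>

lemma kernel_integral_diff_bounds:
  assumes g: "g \<in> borel_measurable borel" "\<And>s. s > 0 \<Longrightarrow> g s > 0"
    and int: "set_integrable lborel {0<..} (\<lambda>s. s powr \<alpha> / g s)"
    and h: "h \<in> borel_measurable borel" "\<And>s. s > 0 \<Longrightarrow> h s > 0"
    and int': "set_integrable lborel {0<..} (\<lambda>s. s powr \<alpha> / h s)"
    and le: "\<And>s. s > 0 \<Longrightarrow> g s \<le> h s"
  shows "kernel_integral \<alpha> h x \<le> kernel_integral \<alpha> g x"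
    and "kernel_integral \<alpha> g x \<le> kernel_integral \<alpha> h x +
      ((LBINT s:{0<..}. s powr \<alpha> / g s) - (LBINT s:{0<..}. s powr \<alpha> / h s))"
proof -
  let ?q = "\<lambda>s. x\<^sup>2 / (x\<^sup>2 + s\<^sup>2)"
  have w: "s powr \<alpha> / h s \<le> s powr \<alpha> / g s" if "s > 0" for s
    using le[OF that] g(2)[OF that] h(2)[OF that] by (intro divide_left_mono) auto
  note ig = kernel_integral_integrable[OF g int, of x] and ih = kernel_integral_integrable[OF h int', of x]
  show "kernel_integral \<alpha> h x \<le> kernel_integral \<alpha> g x"
    unfolding kernel_integral_def
  proof (rule set_integral_mono[OF ih ig])
    fix s :: real assume "s \<in> {0<..}"
    then have s: "s > 0" by simp
    show "s powr \<alpha> / h s * ?q s \<le> s powr \<alpha> / g s * ?q s"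
      by (rule mult_right_mono[OF w[OF s] square_fraction_bounds(1)[OF s]])
  qed
  have "kernel_integral \<alpha> g x - kernel_integral \<alpha> h x =
      (LBINT s:{0<..}. s powr \<alpha> / g s * ?q s - s powr \<alpha> / h s * ?q s)"
    unfolding kernel_integral_def by (rule set_integral_diff(2)[OF ig ih, symmetric])
  also have "\<dots> \<le> (LBINT s:{0<..}. s powr \<alpha> / g s - s powr \<alpha> / h s)"
  proof (rule set_integral_mono[OF set_integral_diff(1)[OF ig ih] set_integral_diff(1)[OF int int']])
    fix s :: real assume "s \<in> {0<..}"
    then have s: "s > 0" by simp
    have "(s powr \<alpha> / g s - s powr \<alpha> / h s) * ?q s \<le> (s powr \<alpha> / g s - s powr \<alpha> / h s)"
      using w[OF s] square_fraction_bounds[OF s, of x] by (intro mult_right_le_one_le) auto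
    then show "s powr \<alpha> / g s * ?q s - s powr \<alpha> / h s * ?q s \<le> s powr \<alpha> / g s - s powr \<alpha> / h s"
      by (simp only: left_diff_distrib)
  qed
  also have "\<dots> = (LBINT s:{0<..}. s powr \<alpha> / g s) - (LBINT s:{0<..}. s powr \<alpha> / h s)"
    by (rule set_integral_diff(2)[OF int int'])
  finally show "kernel_integral \<alpha> g x \<le> kernel_integral \<alpha> h x +
      ((LBINT s:{0<..}. s powr \<alpha> / g s) - (LBINT s:{0<..}. s powr \<alpha> / h s))" by simp
qed

text \<open>Dominated convergence with majorant \<open>t powr \<alpha> / sinh t\<close>. The choices
  \<open>p x = x * sin x\<close> and \<open>p x = x^2\<close> give \<open>H\<close> and
  \<open>kernel_integral\<close>.\<close>

lemma continuous_on_sinh_kernel_integral: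
  fixes p :: "real \<Rightarrow> real"
  assumes "\<alpha> > 0" and p: "continuous_on UNIV p" "\<And>x. \<bar>p x\<bar> \<le> x\<^sup>2"
  shows "continuous_on UNIV (\<lambda>x. LBINT t:{0<..}. t powr \<alpha> / sinh t * (p x / (x\<^sup>2 + t\<^sup>2)))"
proof (rule continuous_on_sequentiallyI)
  fix u :: "nat \<Rightarrow> real" and a assume u: "u \<longlonglongrightarrow> a"
  show "(\<lambda>n. LBINT t:{0<..}. t powr \<alpha> / sinh t * (p (u n) / ((u n)\<^sup>2 + t\<^sup>2)))
      \<longlonglongrightarrow> (LBINT t:{0<..}. t powr \<alpha> / sinh t * (p a / (a\<^sup>2 + t\<^sup>2)))"
  proof (rule set_dominated_convergence[OF _ _ _ powr_div_sinh_integrable[OF \<open>\<alpha> > 0\<close>]])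
    have "(\<lambda>n. p (u n)) \<longlonglongrightarrow> p a"
      using p(1) u by (auto simp: continuous_on_eq_continuous_at intro: isCont_tendsto_compose)
    moreover have "a\<^sup>2 + t\<^sup>2 \<noteq> 0" if "t \<in> {0<..}" for t
      using that by (simp add: sum_power2_eq_zero_iff)
    ultimately show "(\<lambda>n. t powr \<alpha> / sinh t * (p (u n) / ((u n)\<^sup>2 + t\<^sup>2)))
        \<longlonglongrightarrow> t powr \<alpha> / sinh t * (p a / (a\<^sup>2 + t\<^sup>2))" if "t \<in> {0<..}" for t
      using that u by (intro tendsto_intros) auto
    show "\<bar>t powr \<alpha> / sinh t * (p (u n) / ((u n)\<^sup>2 + t\<^sup>2))\<bar> \<le> t powr \<alpha> / sinh t"
      if "t \<in> {0<..}" for n t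
    proof -
      have t: "t > 0" using that by simp
      have "\<bar>p (u n)\<bar> / ((u n)\<^sup>2 + t\<^sup>2) \<le> (u n)\<^sup>2 / ((u n)\<^sup>2 + t\<^sup>2)"
        using p(2) by (intro divide_right_mono) auto
      also have "\<dots> \<le> 1" using square_fraction_bounds[OF t] by blast
      finally have "\<bar>t powr \<alpha> / sinh t\<bar> * \<bar>p (u n) / ((u n)\<^sup>2 + t\<^sup>2)\<bar> \<le> \<bar>t powr \<alpha> / sinh t\<bar> * 1"
        by (intro mult_left_mono) (auto simp: abs_divide)
      then show ?thesis unfolding abs_mult[symmetric] using t by simp
    qed
  qed measurable
qed

lemma continuous_on_H:
  assumes "\<alpha> > 0"
  shows "continuous_on UNIV (H \<alpha>)"
  unfolding H_def[abs_def]
proof (intro continuous_on_sinh_kernel_integral assms continuous_intros)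
  fix x :: real
  have "\<bar>x * sin x\<bar> \<le> \<bar>x\<bar> * \<bar>x\<bar>"
    unfolding abs_mult by (intro mult_left_mono abs_sin_x_le_abs_x) simp
  then show "\<bar>x * sin x\<bar> \<le> x\<^sup>2" by (simp add: power2_eq_square)
qed

lemma continuous_on_kernel_integral_sinh:
  assumes "\<alpha> > 0"
  shows "continuous_on UNIV (kernel_integral \<alpha> sinh)"
  unfolding kernel_integral_def[abs_def]
  by (intro continuous_on_sinh_kernel_integral assms continuous_intros) simp

lemma abs_H_eq_kernel_integral:
  assumes "x > 0"
  shows "\<bar>H \<alpha> x\<bar> = \<bar>sin x\<bar> / x * kernel_integral \<alpha> sinh x"
proof -
  have "H \<alpha> x = (LBINT t:{0<..}. sin x / x * (t powr \<alpha> / sinh t * (x\<^sup>2 / (x\<^sup>2 + t\<^sup>2))))"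
    unfolding H_def using assms
    by (intro arg_cong[where f = "set_lebesgue_integral lborel {0<..}"] ext) (simp add: power2_eq_square)
  also have "\<dots> = sin x / x * kernel_integral \<alpha> sinh x"
    unfolding kernel_integral_def by (rule set_integral_mult_right)
  finally have "\<bar>H \<alpha> x\<bar> = \<bar>sin x / x\<bar> * \<bar>kernel_integral \<alpha> sinh x\<bar>" by (simp only: abs_mult)
  then show ?thesis using assms kernel_integral_nonneg[of sinh \<alpha> x] by simp
qed

text \<open>Dominated convergence: \<open>scaled_sinh\<close> increases with its first argument, so
  the integrand for a fixed large \<open>m\<close> dominates all later ones. Shifting the index by
  \<open>m\<close> makes this hold along the whole sequence.\<close>

lemma integral_powr_div_scaled_sinh_tendsto:
  assumes "\<alpha> > 0"
  shows "(\<lambda>n. LBINT s:{0<..}. s powr \<alpha> / scaled_sinh (2 * real n + 1) s)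
    \<longlonglongrightarrow> (LBINT s:{0<..}. s powr \<alpha> / sinh s)"
proof -
  obtain m :: nat where m: "real m \<ge> \<alpha> + 3" using real_arch_simple by blast
  then have "m > 0" using assms by (cases m) auto
  show ?thesis
  proof (rule LIMSEQ_offset[of _ m], rule set_dominated_convergence[OF _ _ _ integrable_powr_div_scaled_sinh[OF assms m order.refl]])
    fix s :: real assume "s \<in> {0<..}"
    then have s: "s > 0" by simp
    have "filterlim (\<lambda>n. 2 * real (n + m) + 1) at_top sequentially" by real_asymp
    from filterlim_compose[OF scaled_sinh_tendsto this]
    show "(\<lambda>n. s powr \<alpha> / scaled_sinh (2 * real (n + m) + 1) s) \<longlonglongrightarrow> s powr \<alpha> / sinh s"
      using s by (intro tendsto_intros) auto
    fix n
    have "scaled_sinh (real m) s \<le> scaled_sinh (2 * real (n + m) + 1) s"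
      using \<open>m > 0\<close> s by (intro scaled_sinh_mono) auto
    then show "\<bar>s powr \<alpha> / scaled_sinh (2 * real (n + m) + 1) s\<bar> \<le> s powr \<alpha> / scaled_sinh (real m) s"
      using \<open>m > 0\<close> s scaled_sinh_pos[of "real m" s] scaled_sinh_pos[of "2 * real (n + m) + 1" s]
      by (simp add: abs_divide) (intro divide_left_mono; simp)
  qed measurable
qed

section \<open>Asymptotics of the error\<close>

text \<open>At \<open>x = 0\<close> both sides vanish, the right one because \<open>1 / 0 = 0\<close>.\<close>

lemma interp_poly_error_scaled:
  fixes b :: real and n :: nat
  defines "N \<equiv> 2 * real n + 1"
  assumes b: "0 < b" "b < 2" and "k \<le> n" and \<alpha>: "\<alpha> = 2 * real k + b"
    and x: "0 \<le> x" "x \<le> pi / 2"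
  shows "N powr \<alpha> * \<bar>\<bar>sin x\<bar> powr \<alpha> - poly (interp_poly \<alpha> n) (sin x)\<bar> =
    2 / pi * \<bar>sin (pi * \<alpha> / 2)\<bar> *
      (\<bar>sin (N * x)\<bar> / (N * sin x) * kernel_integral \<alpha> (scaled_sinh N) (N * sin x))"
proof -
  have N: "N > 0" by (simp add: N_def)
  define X where "X = N * sin x"
  define I where "I = (LBINT t:{0<..}. t powr \<alpha> * (sin x * sin (N * x)) /
        (((sin x)\<^sup>2 + t\<^sup>2) * sinh (N * arsinh t)))"
  have err: "\<bar>sin x\<bar> powr \<alpha> - poly (interp_poly \<alpha> n) (sin x) = 2 / pi * sin (pi * \<alpha> / 2) * I"
    unfolding I_def N_def by (rule interp_poly_error[OF b \<open>k \<le> n\<close> \<alpha>])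
  show ?thesis
  proof (cases "sin x = 0")
    case True
    then show ?thesis unfolding err I_def by (simp add: set_lebesgue_integral_def)
  next
    case False
    then have "sin x > 0" using x sin_ge_zero[of x] by simp
    then have X: "X > 0" using N by (simp add: X_def)
    \<comment> \<open>The substitution \<open>t = s / N\<close> produces
      \<open>scaled_sinh N\<close> and a factor \<open>1 / N powr \<alpha>\<close>, which the
      normalisation of the error cancels.\<close>
    have "I = 1 / N * (LBINT s:{0<..}. (1 / N * s) powr \<alpha> * (sin x * sin (N * x)) /
        (((sin x)\<^sup>2 + (1 / N * s)\<^sup>2) * sinh (N * arsinh (1 / N * s))))"
      unfolding I_def using N by (intro set_integral_Ioi_scale(2)) simp
    also have "(LBINT s:{0<..}. (1 / N * s) powr \<alpha> * (sin x * sin (N * x)) /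
        (((sin x)\<^sup>2 + (1 / N * s)\<^sup>2) * sinh (N * arsinh (1 / N * s)))) =
      (LBINT s:{0<..}. N * sin (N * x) / (N powr \<alpha> * X) *
        (s powr \<alpha> / scaled_sinh N s * (X\<^sup>2 / (X\<^sup>2 + s\<^sup>2))))"
    proof (rule set_lebesgue_integral_cong)
      show "\<forall>s. s \<in> {0<..} \<longrightarrow> (1 / N * s) powr \<alpha> * (sin x * sin (N * x)) /
        (((sin x)\<^sup>2 + (1 / N * s)\<^sup>2) * sinh (N * arsinh (1 / N * s))) =
        N * sin (N * x) / (N powr \<alpha> * X) * (s powr \<alpha> / scaled_sinh N s * (X\<^sup>2 / (X\<^sup>2 + s\<^sup>2)))"
      proof safe
        fix s :: real assume s: "s > 0"
        have 1: "(1 / N * s) powr \<alpha> = s powr \<alpha> / N powr \<alpha>"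
          using N s by (simp add: powr_divide)
        have 2: "(sin x)\<^sup>2 + (1 / N * s)\<^sup>2 = (X\<^sup>2 + s\<^sup>2) / N\<^sup>2" "sin x = X / N"
          using N by (simp_all add: X_def field_simps)
        have 3: "sinh (N * arsinh (1 / N * s)) = scaled_sinh N s"
          by (simp add: scaled_sinh_def)
        have 4: "X\<^sup>2 + s\<^sup>2 > 0" "scaled_sinh N s > 0" "N powr \<alpha> > 0"
          using N X s by (simp_all add: add_pos_pos scaled_sinh_pos)
        show "(1 / N * s) powr \<alpha> * (sin x * sin (N * x)) /
          (((sin x)\<^sup>2 + (1 / N * s)\<^sup>2) * sinh (N * arsinh (1 / N * s))) =
          N * sin (N * x) / (N powr \<alpha> * X) * (s powr \<alpha> / scaled_sinh N s * (X\<^sup>2 / (X\<^sup>2 + s\<^sup>2)))"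
          unfolding 1 2(1) 3 2(2) using N X 4
          by (simp add: divide_simps) (simp add: power2_eq_square)
      qed
    qed simp
    also have "\<dots> = N * sin (N * x) / (N powr \<alpha> * X) * kernel_integral \<alpha> (scaled_sinh N) X"
      unfolding kernel_integral_def by (rule set_integral_mult_right)
    finally have "N powr \<alpha> * I = sin (N * x) / X * kernel_integral \<alpha> (scaled_sinh N) X"
      using N by simp
    then have "N powr \<alpha> * (\<bar>sin x\<bar> powr \<alpha> - poly (interp_poly \<alpha> n) (sin x)) =
        2 / pi * sin (pi * \<alpha> / 2) * (sin (N * x) / X * kernel_integral \<alpha> (scaled_sinh N) X)"
      unfolding err mult.left_commute[of "N powr \<alpha>"] by (rule arg_cong)
    then have "\<bar>N powr \<alpha>\<bar> * \<bar>\<bar>sin x\<bar> powr \<alpha> - poly (interp_poly \<alpha> n) (sin x)\<bar> =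
        \<bar>2 / pi * sin (pi * \<alpha> / 2)\<bar> * (\<bar>sin (N * x)\<bar> / \<bar>X\<bar> * \<bar>kernel_integral \<alpha> (scaled_sinh N) X\<bar>)"
      by (simp only: flip: abs_mult abs_divide)
    moreover have "kernel_integral \<alpha> (scaled_sinh N) X \<ge> 0"
      using N by (intro kernel_integral_nonneg scaled_sinh_pos)
    ultimately show ?thesis
      using N \<open>sin x > 0\<close> by (simp add: abs_mult X_def)
  qed
qed

lemma abs_H_bounded:
  assumes "\<alpha> > 0"
  shows "bdd_above (range (\<lambda>x. \<bar>H \<alpha> x\<bar>))"
proof (rule bdd_aboveI2)
  fix x
  have "\<bar>H \<alpha> x\<bar> \<le> (LBINT t:{0<..}. \<bar>t powr \<alpha> / sinh t * (x * sin x / (x\<^sup>2 + t\<^sup>2))\<bar>)"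
    using set_integral_norm_bound[OF H_integrable[OF assms, of x]]
    unfolding H_def real_norm_def .
  also have "\<dots> \<le> (LBINT t:{0<..}. t powr \<alpha> / sinh t)"
    by (intro set_integral_mono set_integrable_abs H_integrable powr_div_sinh_integrable
        assms H_integrand_bound) simp
  finally show "\<bar>H \<alpha> x\<bar> \<le> (LBINT t:{0<..}. t powr \<alpha> / sinh t)" .
qed

text \<open>The interval is split at a fixed \<open>h\<close>. Below \<open>h\<close>, monotonicity
  raises the kernel argument from \<open>N * sin x\<close> to \<open>N * x\<close>, the passage to
  \<open>sinh\<close> costs at most \<open>D n\<close>, and \<open>x / sin x\<close> is close to 1.
  Above \<open>h\<close>, the expression is at most \<open>C n / (N * sin h)\<close>, which tends to
  0.\<close>

lemma eventually_scaled_error_le: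
  assumes "\<alpha> > 0" and M: "\<And>y. y > 0 \<Longrightarrow> \<bar>H \<alpha> y\<bar> \<le> M" and "e > 0"
  shows "\<forall>\<^sub>F n in sequentially. \<forall>x\<in>{0<..pi / 2}.
    \<bar>sin ((2 * real n + 1) * x)\<bar> / ((2 * real n + 1) * sin x) *
      kernel_integral \<alpha> (scaled_sinh (2 * real n + 1)) ((2 * real n + 1) * sin x) \<le> M + e"
proof -
  have "M \<ge> 0" using M[of 1] by (meson abs_ge_zero order_trans zero_less_one)
  \<comment> \<open>Chosen so that \<open>r * (M + 1 + r) \<le> r * (M + 2) \<le> e\<close>; the
    same \<open>r\<close> bounds both the relative error of \<open>x / sin x\<close> and the gap
    \<open>D n\<close>.\<close>
  define r where "r = min 1 (e / (M + 2))"
  have r: "r > 0" "(1 + r) * (M + r) \<le> M + e"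
  proof -
    show "r > 0" using \<open>M \<ge> 0\<close> \<open>e > 0\<close> by (simp add: r_def)
    have "r * (M + 1 + r) \<le> r * (M + 2)"
      using \<open>r > 0\<close> by (intro mult_left_mono) (auto simp: r_def)
    also have "\<dots> \<le> e / (M + 2) * (M + 2)"
      using \<open>M \<ge> 0\<close> by (intro mult_right_mono) (auto simp: r_def)
    also have "\<dots> = e" using \<open>M \<ge> 0\<close> by simp
    finally show "(1 + r) * (M + r) \<le> M + e" by (simp add: algebra_simps)
  qed
  have "((\<lambda>x::real. x / sin x) \<longlongrightarrow> 1) (at_right 0)" by real_asymp
  then have "\<forall>\<^sub>F x in at_right (0::real). x / sin x < 1 + r"
    by (rule order_tendstoD) (use r in simp)
  then obtain d where d: "d > 0" "\<And>x. 0 < x \<Longrightarrow> x < d \<Longrightarrow> x / sin x < 1 + r"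
    unfolding eventually_at_right_field by auto
  define h where "h = min d (pi / 2)"
  have h: "0 < h" "h \<le> pi / 2" "sin h > 0"
  proof -
    show h: "0 < h" "h \<le> pi / 2" using d(1) by (auto simp: h_def)
    then show "sin h > 0" using pi_gt_zero by (intro sin_gt_zero) linarith+
  qed
  define D where "D n = (LBINT s:{0<..}. s powr \<alpha> / scaled_sinh (2 * real n + 1) s) -
      (LBINT s:{0<..}. s powr \<alpha> / sinh s)" for n
  define C where "C n = (LBINT s:{0<..}. s powr \<alpha> / scaled_sinh (2 * real n + 1) s)" for n
  have Ctend: "C \<longlonglongrightarrow> (LBINT s:{0<..}. s powr \<alpha> / sinh s)"
    unfolding C_def[abs_def] by (rule integral_powr_div_scaled_sinh_tendsto[OF \<open>\<alpha> > 0\<close>])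
  have "(\<lambda>n. C n - (LBINT s:{0<..}. s powr \<alpha> / sinh s)) \<longlonglongrightarrow>
      (LBINT s:{0<..}. s powr \<alpha> / sinh s) - (LBINT s:{0<..}. s powr \<alpha> / sinh s)"
    by (intro tendsto_intros Ctend)
  then have "D \<longlonglongrightarrow> 0" by (simp add: C_def D_def[abs_def])
  then have ev1: "\<forall>\<^sub>F n in sequentially. D n < r" by (rule order_tendstoD) (rule r)
  have "(\<lambda>n. inverse (2 * real n + 1)) \<longlonglongrightarrow> 0" by real_asymp
  with Ctend have "(\<lambda>n. C n * inverse (2 * real n + 1)) \<longlonglongrightarrow> (LBINT s:{0<..}. s powr \<alpha> / sinh s) * 0"
    by (rule tendsto_mult)
  then have "(\<lambda>n. C n * inverse (2 * real n + 1) / sin h) \<longlonglongrightarrow> (LBINT s:{0<..}. s powr \<alpha> / sinh s) * 0 / sin h"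
    by (rule tendsto_divide) (use h in simp_all)
  then have ev2: "\<forall>\<^sub>F n in sequentially. C n * inverse (2 * real n + 1) / sin h < e"
    by (rule order_tendstoD) (use \<open>e > 0\<close> in simp)
  obtain m :: nat where m: "real m \<ge> \<alpha> + 3" using real_arch_simple by blast
  show ?thesis
    using ev1 ev2 eventually_ge_at_top[of m]
  proof (eventually_elim, intro ballI)
    fix n x
    assume n: "D n < r" "C n * inverse (2 * real n + 1) / sin h < e" "m \<le> n" and x: "x \<in> {0<..pi / 2}"
    define N where "N = 2 * real n + 1"
    define X where "X = N * sin x"
    have N: "N > 0" "N \<ge> real m" using n(3) by (auto simp: N_def)
    have "sin x > 0" using x pi_gt_zero by (intro sin_gt_zero) auto
    then have X: "X > 0" using N by (simp add: X_def)
    have g: "scaled_sinh N \<in> borel_measurable borel" "\<And>s. s > 0 \<Longrightarrow> scaled_sinh N s > 0"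
      "set_integrable lborel {0<..} (\<lambda>s. s powr \<alpha> / scaled_sinh N s)"
      using N scaled_sinh_pos[of N] integrable_powr_div_scaled_sinh[OF \<open>\<alpha> > 0\<close> m N(2)] by auto
    have nonneg: "kernel_integral \<alpha> (scaled_sinh N) X \<ge> 0"
      using g(2) by (rule kernel_integral_nonneg)
    have "\<bar>sin (N * x)\<bar> / X * kernel_integral \<alpha> (scaled_sinh N) X \<le> M + e"
    proof (cases "x < h")
      case True
      have Nx: "N * x > 0" using N x by simp
      have "X \<le> N * x" unfolding X_def using N x sin_x_le_x[of x] by (intro mult_left_mono) auto
      then have "kernel_integral \<alpha> (scaled_sinh N) X \<le> kernel_integral \<alpha> (scaled_sinh N) (N * x)"
        using X g by (intro kernel_integral_mono) auto
      also have "\<dots> \<le> kernel_integral \<alpha> sinh (N * x) + D n"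
        unfolding D_def N_def[symmetric]
        by (rule kernel_integral_diff_bounds(2)[OF g])
          (use powr_div_sinh_integrable[OF \<open>\<alpha> > 0\<close>] N scaled_sinh_le_sinh in auto)
      also have "\<dots> \<le> kernel_integral \<alpha> sinh (N * x) + r" using n(1) by simp
      finally have "\<bar>sin (N * x)\<bar> / X * kernel_integral \<alpha> (scaled_sinh N) X \<le>
          \<bar>sin (N * x)\<bar> / X * (kernel_integral \<alpha> sinh (N * x) + r)"
        using X by (intro mult_left_mono) auto
      \<comment> \<open>Factoring out \<open>N * x / X\<close> exposes
        \<open>\<bar>H \<alpha> (N * x)\<bar>\<close>, which is at most \<open>M\<close>, and leaves
        \<open>r\<close> with a factor at most 1.\<close>
      also have "\<dots> = N * x / X * (\<bar>H \<alpha> (N * x)\<bar> + \<bar>sin (N * x)\<bar> / (N * x) * r)"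
        unfolding abs_H_eq_kernel_integral[OF Nx] using Nx X by (simp add: divide_simps) (simp add: algebra_simps)
      also have "\<dots> \<le> N * x / X * (M + 1 * r)"
        using X Nx r(1) M[OF Nx] abs_sin_x_le_abs_x[of "N * x"]
        by (intro mult_left_mono add_mono mult_right_mono) auto
      also have "N * x / X = x / sin x"
        using N by (simp add: X_def)
      also have "x / sin x * (M + 1 * r) \<le> (1 + r) * (M + r)"
      proof -
        have "x / sin x \<le> 1 + r" using d(2)[of x] x True by (simp add: h_def)
        from mult_right_mono[OF this, of "M + r"] show ?thesis using \<open>M \<ge> 0\<close> r(1) by simp
      qed
      also have "\<dots> \<le> M + e" by (rule r)
      finally show ?thesis .
    next
      case False
      have "\<bar>sin (N * x)\<bar> / X * kernel_integral \<alpha> (scaled_sinh N) X \<le> 1 / X * C n"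
        unfolding C_def N_def[symmetric] using X nonneg
        by (intro mult_mono kernel_integral_le g divide_right_mono) auto
      also have "\<dots> \<le> 1 / (N * sin h) * C n"
      proof (rule mult_right_mono)
        have "sin h \<le> sin x" using False h x by (intro sin_monotone_2pi_le) auto
        then show "1 / X \<le> 1 / (N * sin h)"
          unfolding X_def using N h by (intro divide_left_mono) auto
        show "C n \<ge> 0"
          using nonneg kernel_integral_le[OF g, of X] unfolding C_def N_def[symmetric] by linarith
      qed
      also have "\<dots> = C n * inverse (2 * real n + 1) / sin h"
        by (simp add: N_def field_simps)
      also have "\<dots> \<le> M + e" using n(2) \<open>M \<ge> 0\<close> by simp
      finally show ?thesis .
    qed
    then show "\<bar>sin ((2 * real n + 1) * x)\<bar> / ((2 * real n + 1) * sin x) *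
      kernel_integral \<alpha> (scaled_sinh (2 * real n + 1)) ((2 * real n + 1) * sin x) \<le> M + e"
      unfolding X_def N_def .
  qed
qed

text \<open>With \<open>y\<close> fixed, the argument \<open>X n\<close> tends to \<open>y\<close>.
  Since \<open>scaled_sinh N \<le> sinh\<close>, the expression is at least the one with
  \<open>sinh\<close>, which tends to \<open>\<bar>H \<alpha> y\<bar>\<close> by continuity.\<close>

lemma eventually_scaled_error_gt:
  assumes "\<alpha> > 0" "y > 0" "a < \<bar>H \<alpha> y\<bar>"
  shows "\<forall>\<^sub>F n in sequentially.
    a < \<bar>sin y\<bar> / ((2 * real n + 1) * sin (y / (2 * real n + 1))) *
      kernel_integral \<alpha> (scaled_sinh (2 * real n + 1)) ((2 * real n + 1) * sin (y / (2 * real n + 1)))"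
proof -
  define X where "X n = (2 * real n + 1) * sin (y / (2 * real n + 1))" for n
  have lim: "X \<longlonglongrightarrow> y" unfolding X_def using \<open>y > 0\<close> by real_asymp
  have "isCont (kernel_integral \<alpha> sinh) y"
    using continuous_on_kernel_integral_sinh[OF \<open>\<alpha> > 0\<close>] by (simp add: continuous_on_eq_continuous_at)
  then have "(\<lambda>n. kernel_integral \<alpha> sinh (X n)) \<longlonglongrightarrow> kernel_integral \<alpha> sinh y"
    using lim by (rule isCont_tendsto_compose)
  then have "(\<lambda>n. \<bar>sin y\<bar> / X n * kernel_integral \<alpha> sinh (X n)) \<longlonglongrightarrow> \<bar>sin y\<bar> / y * kernel_integral \<alpha> sinh y"
    using lim \<open>y > 0\<close> by (intro tendsto_intros) auto
  then have ev1: "\<forall>\<^sub>F n in sequentially. a < \<bar>sin y\<bar> / X n * kernel_integral \<alpha> sinh (X n)"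
    by (rule order_tendstoD) (use assms abs_H_eq_kernel_integral in auto)
  have ev2: "\<forall>\<^sub>F n in sequentially. X n > 0"
    using lim \<open>y > 0\<close> by (rule order_tendstoD)
  obtain m :: nat where m: "real m \<ge> \<alpha> + 3" using real_arch_simple by blast
  show ?thesis
    using ev1 ev2 eventually_ge_at_top[of m]
  proof eventually_elim
    case (elim n)
    define N where "N = 2 * real n + 1"
    have N: "N > 0" "N \<ge> real m" using elim(3) by (auto simp: N_def)
    have "kernel_integral \<alpha> sinh (X n) \<le> kernel_integral \<alpha> (scaled_sinh N) (X n)"
      by (rule kernel_integral_diff_bounds(1))
        (use powr_div_sinh_integrable[OF \<open>\<alpha> > 0\<close>] N scaled_sinh_le_sinh scaled_sinh_pos[of N]
          integrable_powr_div_scaled_sinh[OF \<open>\<alpha> > 0\<close> m N(2)] in auto)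
    then have "\<bar>sin y\<bar> / X n * kernel_integral \<alpha> sinh (X n) \<le> \<bar>sin y\<bar> / X n * kernel_integral \<alpha> (scaled_sinh N) (X n)"
      using elim(2) by (intro mult_left_mono) auto
    with elim(1) show ?case unfolding X_def N_def by linarith
  qed
qed

section \<open>Norms as real suprema\<close>

lemma Linf_norm_eq_real_SUP:
  assumes "S \<in> sets borel" "S \<subseteq> closure (interior S)" "continuous_on S f"
    and "S \<noteq> {}" "bdd_above ((\<lambda>x. \<bar>f x\<bar>) ` S)"
  shows "Linf_norm S f = ereal (SUP x\<in>S. \<bar>f x\<bar>)"
proof -
  have "\<bar>SUP x\<in>S. ereal \<bar>f x\<bar>\<bar> \<noteq> \<infinity>"
  proof -
    obtain x where "x \<in> S" using assms(4) by blast
    then have "0 \<le> (SUP x\<in>S. ereal \<bar>f x\<bar>)" by (intro SUP_upper2[of x]) auto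
    moreover obtain c where "\<And>x. x \<in> S \<Longrightarrow> \<bar>f x\<bar> \<le> c"
      using assms(5) by (auto simp: bdd_above_def)
    then have "(SUP x\<in>S. ereal \<bar>f x\<bar>) \<le> ereal c" by (intro SUP_least) auto
    ultimately show ?thesis by (cases "SUP x\<in>S. ereal \<bar>f x\<bar>") auto
  qed
  then show ?thesis
    unfolding Linf_norm_eq_SUP[OF assms(1-3)] by (rule ereal_SUP[symmetric])
qed

lemma Linf_norm_H_eq_SUP:
  assumes "\<alpha> > 0"
  shows "Linf_norm {0..} (H \<alpha>) = ereal (SUP x\<in>{0..}. \<bar>H \<alpha> x\<bar>)"
proof (rule Linf_norm_eq_real_SUP)
  show "continuous_on {0..} (H \<alpha>)"
    using continuous_on_H[OF assms] by (rule continuous_on_subset) simp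
  show "bdd_above ((\<lambda>x. \<bar>H \<alpha> x\<bar>) ` {0..})"
    using abs_H_bounded[OF assms] by (rule bdd_above_mono) auto
qed auto

lemma continuous_on_interp_error:
  assumes "\<alpha> > 0"
  shows "continuous_on A (\<lambda>x. \<bar>x\<bar> powr \<alpha> - poly (interp_poly \<alpha> n) x)"
  using assms by (intro continuous_intros continuous_on_powr') auto

lemma bdd_above_interp_error:
  assumes "\<alpha> > 0"
  shows "bdd_above ((\<lambda>x. \<bar>\<bar>x\<bar> powr \<alpha> - poly (interp_poly \<alpha> n) x\<bar>) ` {0..1})"
  by (intro bounded_imp_bdd_above compact_imp_bounded compact_continuous_image
      continuous_on_rabs continuous_on_interp_error assms) simp

lemma Linf_norm_interp_error_eq_SUP:
  assumes "\<alpha> > 0"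
  shows "Linf_norm {0..1} (\<lambda>x. \<bar>x\<bar> powr \<alpha> - poly (interp_poly \<alpha> n) x) =
    ereal (SUP x\<in>{0..1}. \<bar>\<bar>x\<bar> powr \<alpha> - poly (interp_poly \<alpha> n) x\<bar>)"
  by (intro Linf_norm_eq_real_SUP continuous_on_interp_error bdd_above_interp_error assms) auto

section \<open>Limit of the scaled error norm\<close>

text \<open>From \<open>n = k\<close> on, the interpolation is exact and the sequence is constantly
  0.\<close>

lemma interp_error_sup_tendsto_even:
  assumes "0 < k" "\<alpha> = 2 * real k"
  shows "(\<lambda>n. (2 * real n) powr \<alpha> * (SUP x\<in>{0..1}. \<bar>\<bar>x\<bar> powr \<alpha> - poly (interp_poly \<alpha> n) x\<bar>))
    \<longlonglongrightarrow> 0"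
proof (rule tendsto_eventually)
  show "\<forall>\<^sub>F n in sequentially.
      (2 * real n) powr \<alpha> * (SUP x\<in>{0..1}. \<bar>\<bar>x\<bar> powr \<alpha> - poly (interp_poly \<alpha> n) x\<bar>) = 0"
    using eventually_ge_at_top[of k]
    by eventually_elim (use assms in \<open>simp add: interp_poly_even\<close>)
qed

text \<open>The limit is first found with \<open>2 * real n + 1\<close> in place of
  \<open>2 * real n\<close>, from a lower estimate at single points \<open>y\<close> and an upper
  estimate uniform in \<open>x\<close>. Excluding \<open>b = 0\<close> makes the constant
  \<open>c\<close> positive, so it can be divided out.\<close>

lemma interp_error_sup_tendsto:
  fixes b :: real
  assumes b: "0 < b" "b < 2" and \<alpha>: "\<alpha> = 2 * real k + b"
  shows "(\<lambda>n. (2 * real n) powr \<alpha> * (SUP x\<in>{0..1}. \<bar>\<bar>x\<bar> powr \<alpha> - poly (interp_poly \<alpha> n) x\<bar>))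
    \<longlonglongrightarrow> 2 / pi * \<bar>sin (pi * \<alpha> / 2)\<bar> * (SUP x\<in>{0..}. \<bar>H \<alpha> x\<bar>)"
proof -
  define c where "c = 2 / pi * \<bar>sin (pi * \<alpha> / 2)\<bar>"
  define M where "M = (SUP x\<in>{0..}. \<bar>H \<alpha> x\<bar>)"
  define E where "E n x = \<bar>\<bar>x\<bar> powr \<alpha> - poly (interp_poly \<alpha> n) x\<bar>" for n x
  define Q where "Q n = (SUP x\<in>{0..1}. E n x)" for n
  have "\<alpha> > 0" using b \<alpha> by simp
  have bdd: "bdd_above ((\<lambda>x. \<bar>H \<alpha> x\<bar>) ` {0..})"
    using abs_H_bounded[OF \<open>\<alpha> > 0\<close>] by (rule bdd_above_mono) auto
  have HM: "\<bar>H \<alpha> y\<bar> \<le> M" if "y \<ge> 0" for y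
    unfolding M_def using bdd that by (intro cSUP_upper) auto
  have bddE: "bdd_above (E n ` {0..1})" for n
    unfolding E_def by (rule bdd_above_interp_error[OF \<open>\<alpha> > 0\<close>])
  have "c > 0"
  proof -
    have "sin (pi * b / 2) > 0"
      using b by (intro sin_gt_zero) (auto simp: field_simps)
    moreover have "pi * \<alpha> / 2 = pi * b / 2 + real k * pi" by (simp add: \<alpha> field_simps)
    then have "\<bar>sin (pi * \<alpha> / 2)\<bar> = \<bar>sin (pi * b / 2)\<bar>"
      by (simp only: sin_add) (simp add: abs_mult power_abs)
    ultimately show ?thesis by (simp add: c_def)
  qed
  note scaled = interp_poly_error_scaled[OF b _ \<alpha>, folded E_def c_def]
  have lim: "(\<lambda>n. (2 * real n + 1) powr \<alpha> * Q n) \<longlonglongrightarrow> c * M"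
  proof (rule order_tendstoI)
    fix a assume "a < c * M"
    then have "a / c < M" using \<open>c > 0\<close> by (simp add: field_simps)
    then obtain y where y: "y \<ge> 0" "a / c < \<bar>H \<alpha> y\<bar>"
      unfolding M_def using less_cSUP_iff[OF _ bdd] by auto
    show "\<forall>\<^sub>F n in sequentially. a < (2 * real n + 1) powr \<alpha> * Q n"
    proof (cases "y = 0")
      \<comment> \<open>The point estimate needs \<open>y > 0\<close>. For \<open>y = 0\<close> the
        bound \<open>a\<close> is negative, while the scaled error is not.\<close>
      case True
      then have "a < 0" using y(2) \<open>c > 0\<close> by (simp add: H_0 field_simps)
      have "E n 0 \<le> Q n" for n unfolding Q_def using bddE by (intro cSUP_upper) auto
      moreover have "E n 0 \<ge> 0" for n by (simp add: E_def)
      ultimately have "(2 * real n + 1) powr \<alpha> * Q n \<ge> 0" for n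
        by (meson mult_nonneg_nonneg order_trans powr_ge_zero)
      then show ?thesis using \<open>a < 0\<close> by (intro always_eventually allI) (meson less_le_trans)
    next
      case False
      then have "y > 0" using y by simp
      have "\<forall>\<^sub>F n in sequentially. y / (2 * real n + 1) < pi / 2"
      proof (rule order_tendstoD)
        show "(\<lambda>n. y / (2 * real n + 1)) \<longlonglongrightarrow> 0" by real_asymp
      qed simp
      then show ?thesis
        using eventually_scaled_error_gt[OF \<open>\<alpha> > 0\<close> \<open>y > 0\<close> y(2)] eventually_ge_at_top[of k]
      proof eventually_elim
        case (elim n)
        define N where "N = 2 * real n + 1"
        have N: "N > 0" by (simp add: N_def)
        define x where "x = y / N"
        have x: "0 \<le> x" "x \<le> pi / 2" "N * x = y"
          using elim(1) \<open>y > 0\<close> N by (auto simp: x_def N_def)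
        have "a < c * (\<bar>sin y\<bar> / (N * sin x) * kernel_integral \<alpha> (scaled_sinh N) (N * sin x))"
          using elim(2) \<open>c > 0\<close> unfolding N_def[symmetric] x_def[symmetric] by (simp add: field_simps)
        also have "\<dots> = N powr \<alpha> * E n (sin x)"
          using scaled[OF elim(3) x(1,2)] unfolding N_def[symmetric] x(3) by simp
        also have "\<dots> \<le> N powr \<alpha> * Q n"
          unfolding Q_def using bddE x sin_ge_zero[of x] pi_gt_zero
          by (intro mult_left_mono cSUP_upper) auto
        finally show ?case unfolding N_def .
      qed
    qed
  next
    fix a assume "c * M < a"
    \<comment> \<open>Half of the available gap, so that \<open>c * (M + ?e)\<close> is the midpoint
      of \<open>c * M\<close> and \<open>a\<close> and the final inequality remains strict.\<close>
    then have "(a / c - M) / 2 > 0" (is "?e > 0") using \<open>c > 0\<close> by (simp add: field_simps)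
    have "\<forall>\<^sub>F n in sequentially. \<forall>x\<in>{0<..pi / 2}.
      \<bar>sin ((2 * real n + 1) * x)\<bar> / ((2 * real n + 1) * sin x) *
        kernel_integral \<alpha> (scaled_sinh (2 * real n + 1)) ((2 * real n + 1) * sin x) \<le> M + ?e"
      by (rule eventually_scaled_error_le[OF \<open>\<alpha> > 0\<close> _ \<open>?e > 0\<close>]) (simp add: HM)
    then show "\<forall>\<^sub>F n in sequentially. (2 * real n + 1) powr \<alpha> * Q n < a"
      using eventually_ge_at_top[of k]
    proof eventually_elim
      case (elim n)
      define N where "N = 2 * real n + 1"
      have N: "N powr \<alpha> > 0" by (simp add: N_def)
      have "M \<ge> 0" using HM[of 0] by (simp add: H_0)
      have "Q n \<le> c * (M + ?e) / N powr \<alpha>"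
        unfolding Q_def
      proof (rule cSUP_least)
        fix z :: real assume z: "z \<in> {0..1}"
        define x where "x = arcsin z"
        have x: "0 \<le> x" "x \<le> pi / 2" "sin x = z"
          using z arcsin_bounded[of z] arcsin_le_arcsin[of 0 z] by (auto simp: x_def)
        have "\<bar>sin (N * x)\<bar> / (N * sin x) * kernel_integral \<alpha> (scaled_sinh N) (N * sin x) \<le> M + ?e"
        \<comment> \<open>The uniform estimate excludes \<open>x = 0\<close>; there the quotient by
          \<open>N * sin x\<close> is a division by 0, hence 0.\<close>
        proof (cases "x = 0")
          case True
          then show ?thesis using \<open>M \<ge> 0\<close> \<open>?e > 0\<close> by simp
        next
          case False
          then show ?thesis using elim(1) x unfolding N_def by auto
        qed
        then have "c * (\<bar>sin (N * x)\<bar> / (N * sin x) * kernel_integral \<alpha> (scaled_sinh N) (N * sin x)) \<le> c * (M + ?e)"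
          using \<open>c > 0\<close> by (intro mult_left_mono) auto
        then have "N powr \<alpha> * E n z \<le> c * (M + ?e)"
          using scaled[OF elim(2) x(1,2)] unfolding N_def[symmetric] x(3) by simp
        then show "E n z \<le> c * (M + ?e) / N powr \<alpha>"
          using N by (simp add: field_simps)
      qed simp
      then have "N powr \<alpha> * Q n \<le> c * (M + ?e)"
        using N by (simp add: field_simps)
      also have "\<dots> < a"
        using \<open>c * M < a\<close> \<open>c > 0\<close> by (simp add: field_simps)
      finally show ?case unfolding N_def .
    qed
  qed
  \<comment> \<open>The ratio of the two normalisations tends to 1, which passes from
    \<open>2 * real n + 1\<close> to \<open>2 * real n\<close>.\<close>
  have "(\<lambda>n. (2 * real n) powr \<alpha> / (2 * real n + 1) powr \<alpha>) \<longlonglongrightarrow> 1"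
  proof -
    have "(\<lambda>n. 2 * real n / (2 * real n + 1)) \<longlonglongrightarrow> 1" by real_asymp
    then have "(\<lambda>n. (2 * real n / (2 * real n + 1)) powr \<alpha>) \<longlonglongrightarrow> 1 powr \<alpha>"
      by (intro tendsto_intros) auto
    then show ?thesis by (simp add: powr_divide)
  qed
  from tendsto_mult[OF this lim]
  show ?thesis
    by (simp add: c_def M_def Q_def E_def)
qed

theorem theorem3p1:
  fixes \<alpha> :: real
  assumes "\<alpha> > 0"
  shows "(\<lambda>n. ereal ((2 * real n) powr \<alpha>) *
              Linf_norm {0..1} (\<lambda>x. \<bar>x\<bar> powr \<alpha> - poly (interp_poly \<alpha> n) x))
           \<longlonglongrightarrow> ereal (2 / pi * \<bar>sin (pi * \<alpha> / 2)\<bar>) * Linf_norm {0..} (H \<alpha>)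
       \<and> ereal (2 / pi * \<bar>sin (pi * \<alpha> / 2)\<bar>) * Linf_norm {0..} (H \<alpha>) =
         ereal (2 / pi * \<bar>sin (pi * \<alpha> / 2)\<bar>) *
           (SUP x\<in>{0..}. ereal (LBINT t:{0<..}. t powr \<alpha> / sinh t * (x * \<bar>sin x\<bar> / (x\<^sup>2 + t\<^sup>2))))"
proof
  have "(\<lambda>n. (2 * real n) powr \<alpha> * (SUP x\<in>{0..1}. \<bar>\<bar>x\<bar> powr \<alpha> - poly (interp_poly \<alpha> n) x\<bar>))
    \<longlonglongrightarrow> 2 / pi * \<bar>sin (pi * \<alpha> / 2)\<bar> * (SUP x\<in>{0..}. \<bar>H \<alpha> x\<bar>)"
  proof -
    \<comment> \<open>Writing \<open>\<alpha> = 2 * real k + b\<close> with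
      \<open>0 \<le> b < 2\<close> separates the even integers, where \<open>b = 0\<close> and the
      sine factor vanishes, from the case covered by the error formula.\<close>
    define k where "k = nat \<lfloor>\<alpha> / 2\<rfloor>"
    define b where "b = \<alpha> - 2 * real k"
    have k: "real k = of_int \<lfloor>\<alpha> / 2\<rfloor>" using assms by (simp add: k_def)
    have b: "0 \<le> b" "b < 2" unfolding b_def k by linarith+
    show ?thesis
    proof (cases "b = 0")
      case True
      then have *: "\<alpha> = 2 * real k" "0 < k" using assms by (auto simp: b_def)
      have "pi * \<alpha> / 2 = real k * pi" by (simp add: *)
      then have "sin (pi * \<alpha> / 2) = 0" by (simp only: sin_npi)
      then show ?thesis using interp_error_sup_tendsto_even[OF *(2,1)] by simp
    next
      case False
      with b show ?thesis by (intro interp_error_sup_tendsto[of b _ k]) (auto simp: b_def)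
    qed
  qed
  then show "(\<lambda>n. ereal ((2 * real n) powr \<alpha>) *
              Linf_norm {0..1} (\<lambda>x. \<bar>x\<bar> powr \<alpha> - poly (interp_poly \<alpha> n) x))
           \<longlonglongrightarrow> ereal (2 / pi * \<bar>sin (pi * \<alpha> / 2)\<bar>) * Linf_norm {0..} (H \<alpha>)"
    unfolding Linf_norm_interp_error_eq_SUP[OF assms] Linf_norm_H_eq_SUP[OF assms]
      times_ereal.simps by (rule tendsto_ereal)
  \<comment> \<open>For \<open>x \<ge> 0\<close> the only factor of the integrand that changes sign
    is \<open>sin x\<close>, and it does not depend on \<open>t\<close>; the absolute value can
    therefore move inside the integral. Continuity of \<open>H\<close> then identifies the supremum
    with the norm.\<close>
  have "(LBINT t:{0<..}. t powr \<alpha> / sinh t * (x * \<bar>sin x\<bar> / (x\<^sup>2 + t\<^sup>2))) = \<bar>H \<alpha> x\<bar>"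
    if "x \<in> {0..}" for x
  proof (cases "x = 0")
    case True
    then show ?thesis by (simp add: H_0 set_lebesgue_integral_def)
  next
    case False
    then have "x > 0" using that by simp
    have "(LBINT t:{0<..}. t powr \<alpha> / sinh t * (x * \<bar>sin x\<bar> / (x\<^sup>2 + t\<^sup>2))) =
        (LBINT t:{0<..}. \<bar>sin x\<bar> / x * (t powr \<alpha> / sinh t * (x\<^sup>2 / (x\<^sup>2 + t\<^sup>2))))"
      using \<open>x > 0\<close>
      by (intro arg_cong[where f = "set_lebesgue_integral lborel {0<..}"] ext) (simp add: power2_eq_square)
    also have "\<dots> = \<bar>sin x\<bar> / x * kernel_integral \<alpha> sinh x"
      unfolding kernel_integral_def by (rule set_integral_mult_right)
    finally show ?thesis by (simp only: abs_H_eq_kernel_integral[OF \<open>x > 0\<close>])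
  qed
  then have "(SUP x\<in>{0..}. ereal (LBINT t:{0<..}. t powr \<alpha> / sinh t * (x * \<bar>sin x\<bar> / (x\<^sup>2 + t\<^sup>2)))) =
      (SUP x\<in>{0..}. ereal \<bar>H \<alpha> x\<bar>)"
    by (intro SUP_cong) auto
  also have "\<dots> = Linf_norm {0..} (H \<alpha>)"
    using continuous_on_subset[OF continuous_on_H[OF assms]]
    by (intro Linf_norm_eq_SUP[symmetric]) auto
  finally show "ereal (2 / pi * \<bar>sin (pi * \<alpha> / 2)\<bar>) * Linf_norm {0..} (H \<alpha>) =
         ereal (2 / pi * \<bar>sin (pi * \<alpha> / 2)\<bar>) *
           (SUP x\<in>{0..}. ereal (LBINT t:{0<..}. t powr \<alpha> / sinh t * (x * \<bar>sin x\<bar> / (x\<^sup>2 + t\<^sup>2))))"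
    by simp
qed

end
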